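(* There exist infinitely many triples $(a,b,c)$ of positive integers with no common factor ($\gcd(a,b,c)=1$) such that $a+b=c$ and $$c>\operatorname{rad}(abc)\,\exp\left(\frac{6.563\,\sqrt{\log c}}{\log\log c}\right).$$
   Context: For a positive integer $N$, the radical $\operatorname{rad}(N)=\prod_{p\mid N}p$ is the product of the distinct primes dividing $N$. Here $\log$ is the natural logarithm. *)

theory Defs
  imports Complex_Main "HOL-Computational_Algebra.Primes"
begin

definition rad :: "nat \<Rightarrow> nat" where
  "rad n = (\<Prod>p\<in>prime_factors n. p)"

end

theory Submission
  imports Defs
    "HOL-Computational_Algebra.Squarefree"
    "HOL-Library.FuncSet"
    "HOL-Combinatorics.Multiset_Permutations"
    "HOL-Real_Asymp.Real_Asymp"
begin

text \<open>Fix a set \<open>P\<close> of \<open>n\<close> primes below \<open>N\<close> and send an integer vector \<open>x\<close> indexed by \<open>P\<close> to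
\<open>v x = (\<Sum>p\<in>P. x p * ln p)\<close>. If two distinct vectors have values differing by less than \<open>1/T\<close>,
the positive and negative parts of their difference are the exponents of coprime numbers \<open>A > B\<close>
with \<open>0 < A - B < A/T\<close>. The triple \<open>(B, A - B, A)\<close> has radical at most
\<open>\<Prod>P * (A - B) < \<Prod>P * A / T\<close>, while \<open>ln A\<close> is about half of the weighted \<open>\<ell>\<^sup>1\<close> distance
\<open>\<Sum>p\<in>P. \<bar>x p - y p\<bar> * ln p\<close>. So the aim is a family of vectors that is so numerous that many of
them share a bin of width \<open>1/T\<close>, yet in which large subfamilies always contain a pair at small
\<open>\<ell>\<^sup>1\<close> distance.

The family comes from the logistic distribution. Put \<open>\<phi> t = ln (1 + exp t) + ln (1 + exp (- t)) - 1\<close>.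
For any \<open>m\<close> reals, \<open>\<Sum>\<bar>t\<^sub>i - t\<^sub>j\<bar>\<close> over all ordered pairs is at most \<open>2 * m * (\<Sum>\<phi> t\<^sub>i)\<close>
(\<open>sum_abs_diff_le_logistic_cost\<close>); equality holds in the limit for a sample of the logistic
distribution, whose density is \<open>exp (- \<phi> t - 1)\<close>, whose mean cost is \<open>1\<close> and whose entropy is \<open>2\<close>.
Taking vectors whose scaled coordinates \<open>x p * ln p / s\<close> fill the quantile cells of that
distribution evenly yields about \<open>exp (2 * n) * s ^ n / (\<Prod>p\<in>P. ln p)\<close> vectors
(\<open>card_typical_points_ge\<close>, \<open>ln_count_bound_ge\<close>), each of total cost about \<open>n\<close>
(\<open>typical_points_cost_le\<close>). By the pigeonhole principle and the inequality, two vectors in one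
bin are at distance at most about \<open>2 * n * s\<close> (\<open>exists_short_almost_relation\<close>), so
\<open>ln c\<close> is at most about \<open>n * s\<close>. In terms of unimodular lattices, Minkowski's theorem for the
\<open>\<ell>\<^sup>1\<close> ball gives a vector of norm about \<open>n / exp 1\<close>; the energy inequality improves this to
\<open>2 * n / exp 2\<close>.

About primes, the proof uses that \<open>\<Sum>p\<in>P. ln (N / p)\<close> is at least \<open>A * N / ln N\<close> for arbitrarily
large \<open>N\<close>, where \<open>A < 1\<close> is fixed (\<open>many_primes_with_divisible_card\<close>). If this failed for
all large \<open>N\<close>, averaging over scales would contradict \<open>(\<Sum>p\<le>N. 1/p) \<ge> ln (ln N) - const\<close>. With
\<open>s = n * (ln N)\<^sup>2 / exp 1\<close> and \<open>y = N / (n * ln N)\<close>, the number of vectors gives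
\<open>ln T - (\<Sum>p\<in>P. ln p) \<ge> n * (2 - 1 + A * y - ln y) - o n \<ge> n * (2 + ln A) - o n\<close>, and
\<open>sqrt (n * s) / ln (n * s)\<close> is about \<open>n / (2 * sqrt (exp 1))\<close>. Hence every constant below
\<open>4 * sqrt (exp 1) = 6.594...\<close> is reached.\<close>

section \<open>Primes at favourable scales\<close>

abbreviation primes_upto :: "nat \<Rightarrow> nat set" where
  "primes_upto N \<equiv> {p. prime p \<and> p \<le> N}"

lemma finite_primes_upto [simp]: "finite (primes_upto N)"
  by (rule finite_subset[of _ "{..N}"]) auto

lemma harmonic_ge_ln: "(\<Sum>k=1..N. 1 / real k) \<ge> ln (real (Suc N))"
proof (induction N)
  case (Suc N)
  have "ln (real (Suc (Suc N)) / real (Suc N)) \<le> real (Suc (Suc N)) / real (Suc N) - 1"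
    by (intro ln_le_minus_one) auto
  also have "\<dots> = 1 / real (Suc N)" by (simp add: field_simps)
  finally have "ln (real (Suc (Suc N))) - ln (real (Suc N)) \<le> 1 / real (Suc N)"
    by (subst (asm) ln_div) auto
  with Suc show ?case by simp
qed simp

lemma sum_inverse_squares_le: "(\<Sum>k=1..N. 1 / (real k)\<^sup>2) \<le> 2"
proof -
  have "N \<ge> 1 \<Longrightarrow> (\<Sum>k=1..N. 1 / (real k)\<^sup>2) \<le> 2 - 1 / real N"
  proof (induction N rule: dec_induct)
    case (step k)
    have "1 / (real (Suc k))\<^sup>2 \<le> 1 / (real k * real (Suc k))"
      using step by (intro divide_left_mono) (auto simp: power2_eq_square intro!: mult_right_mono)
    also have "\<dots> = 1 / real k - 1 / real (Suc k)"
      using step by (simp add: divide_simps)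
    finally show ?case using step by simp
  qed auto
  then have "N \<ge> 1 \<Longrightarrow> ?thesis" by (smt (verit) divide_nonneg_nonneg of_nat_0_le_iff)
  then show ?thesis by (cases "N = 0") auto
qed

lemma squarefree_eq_prod:
  fixes n :: nat
  assumes "squarefree n"
  shows "n = \<Prod>(prime_factors n)"
proof -
  have "n \<noteq> 0" using assms by (intro notI) auto
  then have "n = (\<Prod>p\<in>prime_factors n. p ^ multiplicity p n)"
    using prime_factorization_nat by blast
  also have "\<dots> = (\<Prod>p\<in>prime_factors n. p)"
    using assms \<open>n \<noteq> 0\<close>
    by (intro prod.cong refl) (auto simp: squarefree_factorial_semiring' in_prime_factors_iff)
  finally show ?thesis .
qed

text \<open>Every \<open>n \<le> N\<close> is a square times a product of distinct primes, so the harmonic sum is at most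
\<open>(\<Sum>1/k\<^sup>2) * (\<Prod>p\<le>N. 1 + 1/p) \<le> 2 * exp (\<Sum>p\<le>N. 1/p)\<close>.\<close>

lemma sum_inverse_primes_ge:
  assumes "N \<ge> 2"
  shows "(\<Sum>p\<in>primes_upto N. 1 / real p) \<ge> ln (ln (real N)) - ln 2"
proof -
  let ?P = "primes_upto N" and ?S = "\<Sum>p\<in>primes_upto N. 1 / real p"
  define f where "f = (\<lambda>n::nat. (square_part n, prime_factors (squarefree_part n)))"
  define w where "w = (\<lambda>(k::nat, S). 1 / (real k)\<^sup>2 * (\<Prod>p\<in>S. 1 / real p))"
  have dec: "n = \<Prod>(prime_factors (squarefree_part n)) * (square_part n)\<^sup>2" for n :: nat
    using squarefree_decompose[of n] squarefree_eq_prod[OF squarefree_squarefree_part[of n]] by simp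
  have inj: "inj_on f {1..N}"
  proof (rule inj_onI)
    fix a b assume "f a = f b"
    then show "a = b" using dec[of a] dec[of b] by (simp add: f_def)
  qed
  have img: "f ` {1..N} \<subseteq> {1..N} \<times> Pow ?P"
  proof (rule image_subsetI)
    fix n assume n: "n \<in> {1..N}"
    have "(square_part n)\<^sup>2 dvd n" "squarefree_part n dvd n"
      using squarefree_decompose[of n] by (auto, metis dvd_triv_left)
    then have "square_part n dvd n" by (meson dvd_power dvd_trans pos2)
    have "square_part n \<le> n" "squarefree_part n \<le> n"
      using n \<open>square_part n dvd n\<close> \<open>squarefree_part n dvd n\<close> by (auto intro!: dvd_imp_le)
    then have "square_part n \<ge> 1" "square_part n \<le> N" "squarefree_part n \<le> N"
      using n by (auto simp: Suc_le_eq intro!: Nat.gr0I)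
    moreover have "squarefree_part n > 0" using n by (auto intro!: Nat.gr0I)
    ultimately show "f n \<in> {1..N} \<times> Pow ?P"
      by (auto simp: f_def in_prime_factors_iff intro: order_trans[OF dvd_imp_le])
  qed
  have "ln (real N) \<le> ln (real (Suc N))" using assms by simp
  also have "\<dots> \<le> (\<Sum>k=1..N. 1 / real k)" by (rule harmonic_ge_ln)
  also have "\<dots> = (\<Sum>n=1..N. w (f n))"
  proof (intro sum.cong refl)
    fix n :: nat
    have "real n = real (\<Prod>(prime_factors (squarefree_part n)) * (square_part n)\<^sup>2)"
      using dec[of n] by metis
    then show "1 / real n = w (f n)"
      by (simp add: w_def f_def prod_dividef)
  qed
  also have "\<dots> = sum w (f ` {1..N})" using inj by (simp add: sum.reindex)
  also have "\<dots> \<le> sum w ({1..N} \<times> Pow ?P)"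
    using img by (intro sum_mono2) (auto simp: w_def intro!: divide_nonneg_nonneg prod_nonneg)
  also have "\<dots> = (\<Sum>k=1..N. 1 / (real k)\<^sup>2) * (\<Sum>S\<in>Pow ?P. \<Prod>p\<in>S. 1 / real p)"
    by (simp add: w_def sum_product sum.cartesian_product)
  also have "(\<Sum>S\<in>Pow ?P. \<Prod>p\<in>S. 1 / real p) = (\<Prod>p\<in>?P. 1 / real p + 1)"
    by (subst prod_add) auto
  also have "(\<Sum>k=1..N. 1 / (real k)\<^sup>2) * (\<Prod>p\<in>?P. 1 / real p + 1) \<le> 2 * (\<Prod>p\<in>?P. exp (1 / real p))"
    by (intro mult_mono sum_inverse_squares_le prod_mono prod_nonneg)
       (auto simp: add.commute)
  also have "\<dots> = 2 * exp ?S" by (simp add: exp_sum)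
  finally have "ln (real N) \<le> 2 * exp ?S" .
  then have "ln (ln (real N)) \<le> ln (2 * exp ?S)"
    using assms by (subst ln_le_cancel_iff) auto
  then show ?thesis by (simp add: ln_mult)
qed

text \<open>With \<open>\<pi>\<close> and \<open>\<theta>\<close> the usual counting functions this is \<open>\<pi> N * ln N - \<theta> N\<close>, that is,
the integral of \<open>\<pi> t / t\<close> up to \<open>N\<close>; the expected size is \<open>N / ln N\<close>.\<close>

definition log_deficit :: "nat \<Rightarrow> real" where
  "log_deficit N = (\<Sum>p\<in>primes_upto N. ln (real N) - ln (real p))"

lemma primes_upto_Suc:
  "primes_upto (Suc N) = (if prime (Suc N) then insert (Suc N) (primes_upto N) else primes_upto N)"
  by (auto simp: le_Suc_eq)

lemma primes_upto_one [simp]: "primes_upto (Suc 0) = {}"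
  by (auto dest: prime_gt_1_nat)

lemma log_deficit_Suc_ge:
  assumes "N \<ge> 1"
  shows "log_deficit (Suc N) - log_deficit N \<ge> card (primes_upto N) / real (Suc N)"
proof -
  have "ln (real N / real (Suc N)) \<le> real N / real (Suc N) - 1"
    using assms by (intro ln_le_minus_one) auto
  also have "\<dots> = - 1 / real (Suc N)" by (simp add: field_simps)
  finally have *: "1 / real (Suc N) \<le> ln (real (Suc N)) - ln (real N)"
    using assms by (subst (asm) ln_div) auto
  have "log_deficit (Suc N) = (\<Sum>p\<in>primes_upto N. ln (real (Suc N)) - ln (real p))"
    by (auto simp: log_deficit_def primes_upto_Suc)
  also have "\<dots> - log_deficit N = real (card (primes_upto N)) * (ln (real (Suc N)) - ln (real N))"
    by (simp add: log_deficit_def flip: sum_subtractf)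
  finally show ?thesis using mult_left_mono[OF *, of "real (card (primes_upto N))"] by simp
qed

text \<open>Summation by parts, twice: the increments of \<open>log_deficit\<close> are essentially \<open>\<pi> k / k\<close>, and
summing \<open>\<pi> k / k\<^sup>2\<close> gives back \<open>\<Sum>1/p\<close>. It transfers the lower bound for \<open>\<Sum>1/p\<close> to an average of
\<open>log_deficit k / k\<^sup>2\<close>.\<close>

lemma sum_log_deficit_ge:
  assumes "N \<ge> 1"
  shows "(\<Sum>k=1..N. log_deficit k / (real k * real (Suc k)))
     \<ge> (\<Sum>p\<in>primes_upto N. 1 / real (Suc p)) - (card (primes_upto N) + log_deficit N) / real (Suc N)"
  using assms
proof (induction N rule: dec_induct)
  case base
  then show ?case by (simp add: log_deficit_def)
next
  case (step N)
  define c where "c = real (card (primes_upto N))"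
  define i :: real where "i = (if prime (Suc N) then 1 else 0)"
  define B where "B = log_deficit N" define B' where "B' = log_deficit (Suc N)"
  define x where "x = real (Suc N)"
  have x: "x > 1" using step by (simp add: x_def)
  have c': "real (card (primes_upto (Suc N))) = c + i"
    by (auto simp: primes_upto_Suc c_def i_def)
  have s': "(\<Sum>p\<in>primes_upto (Suc N). 1 / real (Suc p)) = (\<Sum>p\<in>primes_upto N. 1 / real (Suc p)) + i / (x + 1)"
    by (auto simp: primes_upto_Suc i_def x_def)
  have BB: "B' - B \<ge> c / x"
    using log_deficit_Suc_ge[of N] step unfolding B_def B'_def c_def x_def by auto
  have "(B' - B) / x \<ge> c / (x * (x + 1))"
  proof -
    have "c / (x * (x + 1)) \<le> c / (x * x)"
      using x by (intro divide_left_mono) (auto simp: c_def)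
    also have "\<dots> = (c / x) / x" by simp
    also have "\<dots> \<le> (B' - B) / x" using BB x by (intro divide_right_mono) auto
    finally show ?thesis .
  qed
  moreover have "c / (x * (x + 1)) = c / x - c / (x + 1)" using x by (simp add: field_simps)
  moreover have "B' / (x * (x + 1)) = B' / x - B' / (x + 1)" using x by (simp add: field_simps)
  ultimately have key: "i / (x + 1) - (c + i + B') / (x + 1) + (c + B) / x \<le> B' / (x * (x + 1))"
    by (simp add: add_divide_distrib diff_divide_distrib)
  have IH: "(\<Sum>p\<in>primes_upto N. 1 / real (Suc p)) - (c + B) / x
      \<le> (\<Sum>k=1..N. log_deficit k / (real k * real (Suc k)))"
    using step.IH by (simp add: c_def B_def x_def)
  have "(\<Sum>k=1..Suc N. log_deficit k / (real k * real (Suc k)))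
      = (\<Sum>k=1..N. log_deficit k / (real k * real (Suc k))) + B' / (x * (x + 1))"
    by (simp add: B'_def x_def algebra_simps)
  moreover have "(card (primes_upto (Suc N)) + log_deficit (Suc N)) / real (Suc (Suc N)) = (c + i + B') / (x + 1)"
    using c' by (simp add: B'_def x_def)
  ultimately show ?case using key IH s' by linarith
qed

lemma sum_inverse_Suc_primes_ge:
  assumes "N \<ge> 2"
  shows "(\<Sum>p\<in>primes_upto N. 1 / real (Suc p)) \<ge> ln (ln (real N)) - ln 2 - 1"
proof -
  have "(\<Sum>k=1..N. f k - f (Suc k)) = f 1 - f (Suc N)" for f :: "nat \<Rightarrow> real"
    by (induction N) simp_all
  from this[of "\<lambda>k. 1 / real k"]
  have "(\<Sum>k=1..N. 1 / real k - 1 / real (Suc k)) = 1 - 1 / real (Suc N)" by simp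
  moreover have "(\<Sum>p\<in>primes_upto N. 1 / real p - 1 / real (Suc p)) \<le> (\<Sum>k=1..N. 1 / real k - 1 / real (Suc k))"
    by (intro sum_mono2) (auto simp: field_simps dest: prime_gt_0_nat)
  moreover have "1 / real (Suc N) \<ge> 0" by simp
  ultimately have "(\<Sum>p\<in>primes_upto N. 1 / real p - 1 / real (Suc p)) \<le> 1" by linarith
  then show ?thesis using sum_inverse_primes_ge[OF assms] by (simp add: sum_subtractf)
qed

lemma ln_ln_diff_ge:
  assumes "k \<ge> 3"
  shows "1 / (real (Suc k) * ln (real k)) \<le> ln (ln (real k)) - ln (ln (real (k - 1)))"
proof -
  let ?a = "real (k - 1)" and ?b = "real k"
  have ab: "?a = ?b - 1" "?a > 1" "?b > 1" using assms by auto
  then have l: "ln ?a > 0" "ln ?b > 0" by auto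
  have "ln (?a / ?b) \<le> ?a / ?b - 1" using ab by (intro ln_le_minus_one) auto
  also have "\<dots> = - 1 / ?b" using ab by (simp add: field_simps)
  finally have 1: "1 / ?b \<le> ln ?b - ln ?a" using ab by (subst (asm) ln_div) auto
  have "ln (ln ?a / ln ?b) \<le> ln ?a / ln ?b - 1" using l by (intro ln_le_minus_one) auto
  also have "\<dots> = (ln ?a - ln ?b) / ln ?b" using l by (simp add: diff_divide_distrib)
  finally have 2: "(ln ?b - ln ?a) / ln ?b \<le> ln (ln ?b) - ln (ln ?a)"
    using l by (subst (asm) ln_div) (auto simp: diff_divide_distrib)
  have "1 / (real (Suc k) * ln ?b) \<le> 1 / (?b * ln ?b)"
    using l ab by (intro divide_left_mono mult_right_mono mult_pos_pos) auto
  also have "\<dots> = (1 / ?b) / ln ?b" by simp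
  also have "\<dots> \<le> (ln ?b - ln ?a) / ln ?b" using 1 l by (intro divide_right_mono) auto
  finally show ?thesis using 2 by linarith
qed

text \<open>If \<open>log_deficit k < A * k / ln k\<close> held from some point on, the sums in \<open>sum_log_deficit_ge\<close>
would be at most \<open>A * ln (ln N) + const\<close>, against \<open>ln (ln N) - const\<close> from below.\<close>

lemma log_deficit_large:
  fixes A :: real
  assumes "0 < A" "A < 1"
  shows "\<exists>N\<ge>N0. log_deficit N \<ge> A * real N / ln (real N)"
proof (rule ccontr)
  assume contr: "\<not> ?thesis"
  define M where "M = max N0 3"
  have up: "log_deficit k \<le> A * real k / ln (real k)" if "k \<ge> M" for k
    using contr that unfolding M_def by (meson linear max.boundedE not_le)
  define F where "F = (\<lambda>k. log_deficit k / (real k * real (Suc k)))"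
  have F: "F k \<le> A * (ln (ln (real k)) - ln (ln (real (k - 1))))" if "k \<ge> M" for k
  proof -
    have k: "k \<ge> 3" using that by (simp add: M_def)
    have "F k \<le> (A * real k / ln (real k)) / (real k * real (Suc k))"
      unfolding F_def using up[OF that] by (intro divide_right_mono) auto
    also have "\<dots> = A * (1 / (real (Suc k) * ln (real k)))" using k by (auto simp: divide_simps)
    also have "\<dots> \<le> A * (ln (ln (real k)) - ln (ln (real (k - 1))))"
      using assms by (intro mult_left_mono ln_ln_diff_ge k) auto
    finally show ?thesis .
  qed
  define C where "C = (\<Sum>k=1..M. F k)"
  have sumF: "(\<Sum>k=1..N. F k) \<le> C + A * (ln (ln (real N)) - ln (ln (real M)))" if "N \<ge> M" for N
    using that
  proof (induction N rule: dec_induct)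
    case (step N)
    then show ?case using F[of "Suc N"] by (simp add: algebra_simps)
  qed (simp add: C_def)
  have bound: "(1 - A) * ln (ln (real N)) \<le> C - A * ln (ln (real M)) + ln 2 + 3" if "N \<ge> M" for N
  proof -
    have N: "N \<ge> 3" using that by (simp add: M_def)
    have "card (primes_upto N) \<le> card {1..N}"
      by (intro card_mono) (auto dest: prime_gt_0_nat)
    then have "real (card (primes_upto N)) \<le> real (Suc N)" by simp
    moreover have "log_deficit N \<le> real (Suc N)"
    proof -
      have "ln (real N) \<ge> 1"
        using N exp_le by (subst ln_ge_iff) auto
      then have "A * real N / ln (real N) \<le> A * real N / 1"
        using assms by (intro divide_left_mono) auto
      also have "\<dots> \<le> real N" using assms mult_right_mono[of A 1 "real N"] by simp
      finally show ?thesis using up[OF that] by simp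
    qed
    ultimately have "(card (primes_upto N) + log_deficit N) / real (Suc N) \<le> 2"
      by (simp add: field_simps)
    then show ?thesis
      using sum_log_deficit_ge[of N] sum_inverse_Suc_primes_ge[of N] sumF[OF that] N
      unfolding F_def by (simp add: algebra_simps)
  qed
  have "filterlim (\<lambda>N::nat. (1 - A) * ln (ln (real N))) at_top at_top"
    using assms by real_asymp
  then have "eventually (\<lambda>N. (1 - A) * ln (ln (real N)) > C - A * ln (ln (real M)) + ln 2 + 3) at_top"
    by (simp add: filterlim_at_top_dense)
  then have "eventually (\<lambda>N::nat. False) at_top"
    using eventually_ge_at_top[of M]
    by eventually_elim (use bound in force)
  then show False by simp
qed

text \<open>Divisibility of the cardinality lets the coordinates be shared out evenly among \<open>J\<close> cells later;
discarding fewer than \<open>J\<close> primes costs only \<open>J * ln N\<close>.\<close>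

lemma many_primes_with_divisible_card:
  fixes A :: real
  assumes A: "0 < A" "A < 1" and J: "J \<ge> 1"
  shows "\<exists>N\<ge>N0. \<exists>P\<subseteq>primes_upto N. J dvd card P \<and>
           (\<Sum>p\<in>P. ln (real N) - ln (real p)) \<ge> A * real N / ln (real N)"
proof -
  define A' where "A' = (1 + A) / 2"
  have A': "0 < A'" "A' < 1" "A' > A" using A by (auto simp: A'_def)
  have "eventually (\<lambda>N::nat. real J * ln (real N) \<le> (A' - A) * (real N / ln (real N))) at_top"
    using A' by real_asymp
  then obtain N1 where N1: "\<And>N. N \<ge> N1 \<Longrightarrow> real J * ln (real N) \<le> (A' - A) * (real N / ln (real N))"
    by (auto simp: eventually_at_top_linorder)
  obtain N where N: "N \<ge> max N0 (max N1 1)" "log_deficit N \<ge> A' * real N / ln (real N)"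
    using log_deficit_large[OF A'(1,2)] by blast
  obtain R where R: "R \<subseteq> primes_upto N" "card R = card (primes_upto N) mod J" "finite R"
    by (rule obtain_subset_with_card_n[of "card (primes_upto N) mod J" "primes_upto N"]) auto
  define P where "P = primes_upto N - R"
  have "(\<Sum>p\<in>R. ln (real N) - ln (real p)) \<le> real (card R) * ln (real N)"
  proof (intro sum_bounded_above)
    fix p assume "p \<in> R"
    then have "p \<ge> 1" using R prime_ge_1_nat by blast
    then show "ln (real N) - ln (real p) \<le> ln (real N)" by simp
  qed
  also have "\<dots> \<le> real J * ln (real N)"
    using R J N by (intro mult_right_mono) (auto intro: less_imp_le)
  finally have "(\<Sum>p\<in>R. ln (real N) - ln (real p)) \<le> real J * ln (real N)" .
  moreover have "(\<Sum>p\<in>P. ln (real N) - ln (real p)) = log_deficit N - (\<Sum>p\<in>R. ln (real N) - ln (real p))"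
    unfolding P_def log_deficit_def using R by (intro sum_diff) auto
  ultimately have "(\<Sum>p\<in>P. ln (real N) - ln (real p)) \<ge> A * real N / ln (real N)"
    using N N1[of N] by (simp add: algebra_simps diff_divide_distrib)
  moreover have "J dvd card P"
    using R by (simp add: P_def card_Diff_subset)
  moreover have "P \<subseteq> primes_upto N" by (auto simp: P_def)
  ultimately show ?thesis using N by (intro exI[of _ N] conjI exI[of _ P]) auto
qed

section \<open>An energy inequality for the logistic distribution\<close>

text \<open>If \<open>Y\<close> and \<open>Y'\<close> are independent with the logistic distribution, this is
\<open>E \<bar>x - Y\<bar> - E \<bar>Y - Y'\<bar> / 2\<close>. In terms of the quantile \<open>u = 1 / (1 + exp (- x))\<close> it equals
\<open>- ln (u * (1 - u)) - 1\<close>.\<close>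

definition logistic_cost :: "real \<Rightarrow> real" where
  "logistic_cost x = ln (1 + exp x) + ln (1 + exp (- x)) - 1"

definition nat_entropy :: "real \<Rightarrow> real" where
  "nat_entropy u = - u * ln u - (1 - u) * ln (1 - u)"

text \<open>The Legendre dual of \<open>nat_entropy\<close>; it is the weighted inequality between arithmetic and
geometric mean for \<open>exp x / u\<close> and \<open>1 / (1 - u)\<close>.\<close>

lemma softplus_ge:
  fixes u x :: real
  assumes "0 < u" "u < 1"
  shows "ln (1 + exp x) \<ge> u * x + nat_entropy u"
proof -
  define S where "S = 1 + exp x"
  have S: "S > 0" by (simp add: S_def add_pos_pos)
  have 1: "ln (exp x / (u * S)) \<le> exp x / (u * S) - 1"
    using assms S by (intro ln_le_minus_one) auto
  have 2: "ln (1 / ((1 - u) * S)) \<le> 1 / ((1 - u) * S) - 1"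
    using assms S by (intro ln_le_minus_one) auto
  have "u * ln (exp x / (u * S)) + (1 - u) * ln (1 / ((1 - u) * S))
      \<le> u * (exp x / (u * S) - 1) + (1 - u) * (1 / ((1 - u) * S) - 1)"
    using assms by (intro add_mono mult_left_mono 1 2) auto
  also have "\<dots> = (1 + exp x) / S - 1"
    using assms S by (simp add: field_simps)
  also have "\<dots> = 0" using S by (simp add: S_def)
  also have "ln (exp x / (u * S)) = x - ln u - ln S"
    using assms S by (subst ln_div) (auto simp: ln_mult)
  also have "ln (1 / ((1 - u) * S)) = - ln (1 - u) - ln S"
    using assms S by (subst ln_div) (auto simp: ln_mult)
  finally have "u * x + nat_entropy u \<le> ln S"
    by (simp add: nat_entropy_def algebra_simps)
  then show ?thesis by (simp add: S_def)
qed

lemma logistic_cost_ge: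
  assumes "0 < u" "u < 1"
  shows "logistic_cost x \<ge> (2 * u - 1) * x + 2 * nat_entropy u - 1"
proof -
  have "nat_entropy (1 - u) = nat_entropy u" by (simp add: nat_entropy_def algebra_simps)
  then show ?thesis
    using softplus_ge[OF assms, of x] softplus_ge[of "1 - u" "- x"] assms
    by (simp add: logistic_cost_def algebra_simps)
qed

lemma diff_square_mult_ln_ge:
  fixes z :: real
  assumes "0 \<le> z" "z < 1"
  shows "(1 + z)\<^sup>2 * ln (1 + z) - (1 - z)\<^sup>2 * ln (1 - z) \<ge> 2 * z"
proof -
  define g where "g = (\<lambda>z::real. (1 + z)\<^sup>2 * ln (1 + z) - (1 - z)\<^sup>2 * ln (1 - z) - 2 * z)"
  have "g 0 \<le> g z"
  proof (rule DERIV_nonneg_imp_nondecreasing[OF assms(1)])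
    fix t :: real assume t: "0 \<le> t" "t \<le> z"
    then have t': "0 \<le> t" "t < 1" using assms by auto
    have d1: "((\<lambda>z. (1 + z)\<^sup>2 * ln (1 + z)) has_real_derivative (2 * (1 + t) * ln (1 + t) + (1 + t))) (at t)"
      using t' by (auto intro!: derivative_eq_intros simp: power2_eq_square)
    have d2: "((\<lambda>z. (1 - z)\<^sup>2 * ln (1 - z)) has_real_derivative (- 2 * (1 - t) * ln (1 - t) - (1 - t))) (at t)"
      using t' by (auto intro!: derivative_eq_intros simp: power2_eq_square)
    have "(g has_real_derivative (2 * (1 + t) * ln (1 + t) + (1 + t) - (- 2 * (1 - t) * ln (1 - t) - (1 - t)) - 2 * 1)) (at t)"
      unfolding g_def by (intro DERIV_diff d1 d2 DERIV_cmult DERIV_ident)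
    then have "(g has_real_derivative (2 * ((1 + t) * ln (1 + t) + (1 - t) * ln (1 - t)))) (at t)"
      by (simp add: algebra_simps)
    moreover have "ln (1 / (1 + t)) \<le> 1 / (1 + t) - 1" "ln (1 / (1 - t)) \<le> 1 / (1 - t) - 1"
      using t' by (intro ln_le_minus_one; simp)+
    then have "(1 + t) * (- ln (1 + t)) \<le> (1 + t) * (1 / (1 + t) - 1)"
       "(1 - t) * (- ln (1 - t)) \<le> (1 - t) * (1 / (1 - t) - 1)"
      using t' by (intro mult_left_mono; simp add: ln_div)+
    then have "2 * ((1 + t) * ln (1 + t) + (1 - t) * ln (1 - t)) \<ge> 0"
      using t' by (simp add: right_diff_distrib)
    ultimately show "\<exists>y. (g has_real_derivative y) (at t) \<and> 0 \<le> y" by blast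
  qed
  then show ?thesis by (simp add: g_def)
qed

text \<open>The midpoint rule underestimates the integral of the convex function \<open>t * ln t\<close> over
\<open>{0..2 * m}\<close>; each step of the induction is one unit of the rule.\<close>

lemma sum_odd_mult_ln_le:
  "(\<Sum>i<m. (2 * real i + 1) * ln (2 * real i + 1)) \<le> (real m)\<^sup>2 * ln (2 * real m) - (real m)\<^sup>2 / 2"
proof (induction m)
  case (Suc m)
  have "(2 * real m + 1) * ln (2 * real m + 1)
     \<le> (real m + 1)\<^sup>2 * ln (2 * real m + 2) - (real m)\<^sup>2 * ln (2 * real m) - (2 * real m + 1) / 2"
  proof (cases "m = 0")
    case True
    have "ln (2::real) \<ge> 1 / 2" using ln_le_minus_one[of "1/2 :: real"] by (simp add: ln_div)
    with True show ?thesis by simp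
  next
    case False
    define y where "y = 2 * real m + 1"
    have y: "y > 1" "real m = (y - 1) / 2" using False by (auto simp: y_def)
    have "(1 + 1 / y)\<^sup>2 * ln (1 + 1 / y) - (1 - 1 / y)\<^sup>2 * ln (1 - 1 / y) \<ge> 2 * (1 / y)"
      using y by (intro diff_square_mult_ln_ge) auto
    then have "y\<^sup>2 / 4 * ((1 + 1 / y)\<^sup>2 * ln (1 + 1 / y) - (1 - 1 / y)\<^sup>2 * ln (1 - 1 / y)) \<ge> y\<^sup>2 / 4 * (2 * (1 / y))"
      by (intro mult_left_mono) auto
    moreover have "1 + 1 / y = (y + 1) / y" "1 - 1 / y = (y - 1) / y" using y by (auto simp: field_simps)
    moreover have "ln ((y + 1) / y) = ln (y + 1) - ln y" "ln ((y - 1) / y) = ln (y - 1) - ln y"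
      using y by (auto simp: ln_div)
    moreover have "y\<^sup>2 / 4 * (((y + 1) / y)\<^sup>2 * a - ((y - 1) / y)\<^sup>2 * b) = ((y + 1)\<^sup>2 * a - (y - 1)\<^sup>2 * b) / 4" for a b
      using y by (simp add: field_simps power2_eq_square)
    moreover have "y\<^sup>2 / 4 * (2 * (1 / y)) = y / 2" using y by (simp add: power2_eq_square)
    ultimately have "((y + 1)\<^sup>2 * (ln (y + 1) - ln y) - (y - 1)\<^sup>2 * (ln (y - 1) - ln y)) / 4 \<ge> y / 2"
      by metis
    moreover have "((y + 1)\<^sup>2 * (ln (y + 1) - ln y) - (y - 1)\<^sup>2 * (ln (y - 1) - ln y)) / 4
        = (y + 1)\<^sup>2 / 4 * ln (y + 1) - (y - 1)\<^sup>2 / 4 * ln (y - 1) - y * ln y"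
      by (simp add: field_simps power2_eq_square)
    moreover have "(y + 1)\<^sup>2 / 4 = (real m + 1)\<^sup>2" "(y - 1)\<^sup>2 / 4 = (real m)\<^sup>2"
      by (simp_all add: y_def power2_eq_square algebra_simps)
    moreover have "y + 1 = 2 * real m + 2" "y - 1 = 2 * real m" by (simp_all add: y_def)
    ultimately have "(real m + 1)\<^sup>2 * ln (2 * real m + 2) - (real m)\<^sup>2 * ln (2 * real m) - y * ln y \<ge> y / 2"
      by metis
    then show ?thesis unfolding y_def by linarith
  qed
  with Suc show ?case by (simp add: power2_eq_square field_simps)
qed simp

text \<open>The integral of \<open>nat_entropy\<close> over \<open>{0..1}\<close> is \<open>1/2\<close>, and the function is concave.\<close>

lemma sum_midpoint_entropy_ge:
  assumes "m > 0"
  shows "(\<Sum>i<m. nat_entropy ((2 * real i + 1) / (2 * real m))) \<ge> real m / 2"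
proof -
  define u where "u = (\<lambda>i. (2 * real i + 1) / (2 * real m))"
  have mirror: "1 - u i = u (m - Suc i)" if "i < m" for i
    using that by (simp add: u_def field_simps of_nat_diff)
  have "(\<Sum>i<m. (1 - u i) * ln (1 - u i)) = (\<Sum>i<m. u (m - Suc i) * ln (u (m - Suc i)))"
    by (intro sum.cong refl) (simp_all add: mirror)
  also have "\<dots> = (\<Sum>i<m. u i * ln (u i))"
    by (rule sum.nat_diff_reindex[of "\<lambda>i. u i * ln (u i)"])
  finally have entropy: "(\<Sum>i<m. nat_entropy (u i)) = - 2 * (\<Sum>i<m. u i * ln (u i))"
    by (simp add: nat_entropy_def sum_subtractf sum_negf)
  have odd: "(\<Sum>i<k. 2 * real i + 1) = (real k)\<^sup>2" for k
    by (induction k) (auto simp: power2_eq_square algebra_simps)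
  have "2 * real m * (\<Sum>i<m. u i * ln (u i))
     = (\<Sum>i<m. (2 * real i + 1) * ln (2 * real i + 1) - (2 * real i + 1) * ln (2 * real m))"
    unfolding sum_distrib_left
  proof (intro sum.cong refl)
    fix i
    have "ln (u i) = ln (2 * real i + 1) - ln (2 * real m)"
      using assms unfolding u_def by (subst ln_div) auto
    moreover have "2 * real m * u i = 2 * real i + 1" using assms by (simp add: u_def)
    ultimately show "2 * real m * (u i * ln (u i))
        = (2 * real i + 1) * ln (2 * real i + 1) - (2 * real i + 1) * ln (2 * real m)"
      by (metis mult.assoc right_diff_distrib)
  qed
  also have "\<dots> = (\<Sum>i<m. (2 * real i + 1) * ln (2 * real i + 1)) - (real m)\<^sup>2 * ln (2 * real m)"
    by (simp add: sum_subtractf odd flip: sum_distrib_right)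
  also have "\<dots> \<le> - (real m)\<^sup>2 / 2" using sum_odd_mult_ln_le[of m] by simp
  finally have "2 * (real m * (\<Sum>i<m. u i * ln (u i))) \<le> 2 * (real m * (- real m / 4))"
    by (simp add: power2_eq_square)
  then have "real m * (\<Sum>i<m. u i * ln (u i)) \<le> real m * (- real m / 4)" by linarith
  then have "(\<Sum>i<m. u i * ln (u i)) \<le> - real m / 4"
    by (rule mult_left_le_imp_le) (use assms in simp)
  then show ?thesis using entropy by (simp add: u_def)
qed

lemma sum_abs_diff_sorted:
  fixes f :: "nat \<Rightarrow> real"
  assumes "\<And>i j. i \<le> j \<Longrightarrow> j < m \<Longrightarrow> f i \<le> f j"
  shows "(\<Sum>i<m. \<Sum>j<m. \<bar>f i - f j\<bar>) = 2 * (\<Sum>i<m. (2 * real i + 1 - real m) * f i)"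
  using assms
proof (induction m)
  case (Suc m)
  have a: "(\<Sum>j<m. \<bar>f m - f j\<bar>) = real m * f m - (\<Sum>j<m. f j)"
  proof -
    have "(\<Sum>j<m. \<bar>f m - f j\<bar>) = (\<Sum>j<m. f m - f j)"
      using Suc.prems by (intro sum.cong refl) auto
    then show ?thesis by (simp add: sum_subtractf)
  qed
  have b: "(\<Sum>i<m. \<bar>f i - f m\<bar>) = (\<Sum>j<m. \<bar>f m - f j\<bar>)"
    by (simp add: abs_minus_commute)
  have IH: "(\<Sum>i<m. \<Sum>j<m. \<bar>f i - f j\<bar>) = 2 * (\<Sum>i<m. (2 * real i + 1 - real m) * f i)"
    using Suc by simp
  have "(\<Sum>i<Suc m. \<Sum>j<Suc m. \<bar>f i - f j\<bar>) = (\<Sum>i<m. \<Sum>j<m. \<bar>f i - f j\<bar>) + 2 * (real m * f m - (\<Sum>j<m. f j))"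
    using a b by (simp add: sum.distrib)
  moreover have "(\<Sum>i<Suc m. (2 * real i + 1 - real (Suc m)) * f i)
     = (\<Sum>i<m. (2 * real i + 1 - real m) * f i) - (\<Sum>i<m. f i) + real m * f m"
    by (simp add: algebra_simps sum.distrib sum_subtractf)
  ultimately show ?case using IH by simp
qed simp

text \<open>After sorting, the left side is \<open>2 * m\<close> times \<open>\<Sum>i. (2 * u i - 1) * f i\<close> with the midpoint
quantiles \<open>u i = (2 * i + 1) / (2 * m)\<close>. Bounding each term by the dual inequality
\<open>logistic_cost_ge\<close> leaves \<open>m - 2 * (\<Sum>i. nat_entropy (u i))\<close>, which is not positive.\<close>

lemma sum_abs_diff_le_logistic_cost:
  fixes f :: "'a \<Rightarrow> real"
  assumes "finite I"
  shows "(\<Sum>x\<in>I. \<Sum>y\<in>I. \<bar>f x - f y\<bar>) \<le> 2 * real (card I) * (\<Sum>x\<in>I. logistic_cost (f x))"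
proof (cases "I = {}")
  case False
  define m where "m = card I"
  have m: "m > 0" using assms False by (simp add: m_def card_gt_0_iff)
  obtain xs0 where xs0: "set xs0 = I" "distinct xs0" using finite_distinct_list[OF assms] by blast
  define xs where "xs = sort_key f xs0"
  have xs: "set xs = I" "distinct xs" "sorted (map f xs)" "length xs = m"
    using xs0 by (auto simp: xs_def m_def distinct_card)
  define g where "g = (\<lambda>i. f (xs ! i))"
  have bij: "bij_betw ((!) xs) {..<m} I" using xs by (intro bij_betw_nth) auto
  have reindex: "(\<Sum>x\<in>I. h x) = (\<Sum>i<m. h (xs ! i))" for h :: "'a \<Rightarrow> real"
    by (rule sum.reindex_bij_betw[OF bij, symmetric])
  have mono: "g i \<le> g j" if "i \<le> j" "j < m" for i j
    using sorted_nth_mono[OF xs(3), of i j] that xs(4) by (simp add: g_def)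
  define u where "u = (\<lambda>i. (2 * real i + 1) / (2 * real m))"
  have "real m * ((2 * u i - 1) * g i + 2 * nat_entropy (u i) - 1) \<le> real m * logistic_cost (g i)" if "i < m" for i
    using that by (intro mult_left_mono logistic_cost_ge) (auto simp: u_def field_simps)
  moreover have "real m * ((2 * u i - 1) * g i + 2 * nat_entropy (u i) - 1)
      = (2 * real i + 1 - real m) * g i + real m * (2 * nat_entropy (u i) - 1)" for i
    using m by (simp add: u_def field_simps)
  ultimately have "(\<Sum>i<m. (2 * real i + 1 - real m) * g i + real m * (2 * nat_entropy (u i) - 1))
      \<le> (\<Sum>i<m. real m * logistic_cost (g i))"
    by (intro sum_mono) auto
  then have "(\<Sum>i<m. (2 * real i + 1 - real m) * g i) + real m * (2 * (\<Sum>i<m. nat_entropy (u i)) - real m)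
      \<le> real m * (\<Sum>i<m. logistic_cost (g i))"
    by (simp add: sum.distrib sum_subtractf flip: sum_distrib_left)
  moreover have "real m * (2 * (\<Sum>i<m. nat_entropy (u i)) - real m) \<ge> 0"
    using sum_midpoint_entropy_ge[OF m] by (intro mult_nonneg_nonneg) (auto simp: u_def)
  ultimately have "2 * (\<Sum>i<m. (2 * real i + 1 - real m) * g i) \<le> 2 * real m * (\<Sum>i<m. logistic_cost (g i))"
    by linarith
  also have "2 * (\<Sum>i<m. (2 * real i + 1 - real m) * g i) = (\<Sum>i<m. \<Sum>j<m. \<bar>g i - g j\<bar>)"
    by (rule sum_abs_diff_sorted[symmetric]) (use mono in auto)
  finally show ?thesis by (simp add: reindex g_def m_def)
qed simp

section \<open>Quantile cells and balanced words\<close>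

text \<open>The quantile of order \<open>j / (J + 2)\<close> of the logistic distribution. The nodes \<open>1, ..., J + 1\<close> bound
\<open>J\<close> cells of equal probability \<open>1 / (J + 2)\<close>; the two unbounded tail cells are left out.\<close>

definition logit_node :: "nat \<Rightarrow> nat \<Rightarrow> real" where
  "logit_node J j = ln (real j / real (J + 2 - j))"

lemma logit_node_strict_mono:
  assumes "1 \<le> j" "j < k" "k \<le> J + 1"
  shows "logit_node J j < logit_node J k"
proof -
  have "real j / real (J + 2 - j) < real k / real (J + 2 - k)"
    using assms by (intro frac_less) auto
  then show ?thesis using assms by (simp add: logit_node_def)
qed

lemma logit_node_step_ge:
  assumes "1 \<le> j" "j \<le> J"
  shows "logit_node J (Suc j) - logit_node J j \<ge> (real J + 2) / ((real j + 1) * (real J + 2 - real j))"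
proof -
  define a b where "a = real j" and "b = real J + 2 - real j"
  have ab: "a \<ge> 1" "b \<ge> 2" "real (Suc j) = a + 1" "real (J + 2 - Suc j) = b - 1" "real (J + 2 - j) = b"
    using assms by (auto simp: a_def b_def of_nat_diff)
  have 1: "ln (a / (a + 1)) \<le> a / (a + 1) - 1" using ab by (intro ln_le_minus_one) auto
  have 2: "ln ((b - 1) / b) \<le> (b - 1) / b - 1" using ab by (intro ln_le_minus_one) auto
  have "(real J + 2) / ((a + 1) * b) \<le> (a + 1 + b) / ((a + 1) * b)"
    using ab by (intro divide_right_mono) (auto simp: a_def b_def)
  also have "\<dots> = 1 / (a + 1) + 1 / b" using ab by (simp add: field_simps)
  also have "\<dots> = (1 - a / (a + 1)) + (1 - (b - 1) / b)" using ab by (simp add: field_simps)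
  also have "\<dots> \<le> - ln (a / (a + 1)) - ln ((b - 1) / b)" using 1 2 by linarith
  also have "\<dots> = logit_node J (Suc j) - logit_node J j"
    using ab unfolding logit_node_def ab by (simp add: ln_div a_def[symmetric])
  finally show ?thesis by (simp add: a_def b_def)
qed

lemma abs_logit_node_le:
  assumes "1 \<le> j" "j \<le> J + 1"
  shows "\<bar>logit_node J j\<bar> \<le> ln (real J + 2)"
proof -
  define a b where "a = real j" and "b = real (J + 2 - j)"
  have ab: "a \<ge> 1" "b \<ge> 1" "a \<le> real J + 2" "b \<le> real J + 2" using assms by (auto simp: a_def b_def)
  then have "ln a \<ge> 0" "ln b \<ge> 0" "ln a \<le> ln (real J + 2)" "ln b \<le> ln (real J + 2)" by auto
  moreover have "logit_node J j = ln a - ln b"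
    using ab unfolding logit_node_def a_def[symmetric] b_def[symmetric] by (subst ln_div) auto
  ultimately show ?thesis by linarith
qed

lemma logistic_cost_le:
  assumes "1 \<le> j" "j \<le> J" "logit_node J j \<le> x" "x < logit_node J (Suc j)"
  shows "logistic_cost x \<le> 2 * ln (real J + 2) - 1 - ln (real j) - ln (real (Suc J - j))"
proof -
  define a b where "a = real j" and "b = real (Suc J - j)"
  have ab: "a \<ge> 1" "b \<ge> 1" "a + b = real J + 1" "real (Suc j) = a + 1" "real (J + 2 - j) = b + 1"
      "real (J + 2 - Suc j) = b"
    using assms by (auto simp: a_def b_def of_nat_diff)
  have "exp (- x) \<le> exp (- logit_node J j)" using assms by simp
  also have "\<dots> = (b + 1) / a"
    using ab unfolding logit_node_def ab a_def[symmetric] by (simp add: exp_minus)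
  finally have "1 + exp (- x) \<le> (real J + 2) / a" using ab by (simp add: field_simps)
  then have 1: "ln (1 + exp (- x)) \<le> ln ((real J + 2) / a)"
    using ab by (subst ln_le_cancel_iff) (auto simp: add_pos_pos)
  have "exp x \<le> exp (logit_node J (Suc j))" using assms by simp
  also have "\<dots> = (a + 1) / b"
    using ab unfolding logit_node_def ab by simp
  finally have "1 + exp x \<le> (real J + 2) / b" using ab by (simp add: field_simps)
  then have 2: "ln (1 + exp x) \<le> ln ((real J + 2) / b)"
    using ab by (subst ln_le_cancel_iff) (auto simp: add_pos_pos)
  show ?thesis
    using 1 2 ab unfolding logistic_cost_def a_def[symmetric] b_def[symmetric] by (simp add: ln_div)
qed

lemma card_int_multiples_ge:
  fixes a b d :: real
  assumes "d > 0" "a \<le> b"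
  shows "finite {k::int. a \<le> of_int k * d \<and> of_int k * d < b}"
    and "real (card {k::int. a \<le> of_int k * d \<and> of_int k * d < b}) \<ge> (b - a) / d - 1"
proof -
  have "{k::int. a \<le> of_int k * d \<and> of_int k * d < b} = {\<lceil>a / d\<rceil>..<\<lceil>b / d\<rceil>}"
    using assms by (auto simp: ceiling_le_iff less_ceiling_iff field_simps)
  moreover have "a / d \<le> b / d" using assms by (intro divide_right_mono) auto
  then have "real (nat (\<lceil>b / d\<rceil> - \<lceil>a / d\<rceil>)) \<ge> b / d - a / d - 1" by linarith
  ultimately show "finite {k::int. a \<le> of_int k * d \<and> of_int k * d < b}"
    "real (card {k::int. a \<le> of_int k * d \<and> of_int k * d < b}) \<ge> (b - a) / d - 1"
    by (simp_all add: diff_divide_distrib)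
qed

text \<open>Assignments of a cell to each of \<open>q * J\<close> coordinates in which every cell is used \<open>q\<close> times.\<close>

definition balanced_words :: "nat \<Rightarrow> nat \<Rightarrow> nat list set" where
  "balanced_words J q = permutations_of_multiset (repeat_mset q (mset_set {1..J}))"

lemma finite_balanced_words [simp]: "finite (balanced_words J q)"
  by (simp add: balanced_words_def)

lemma balanced_words_facts:
  assumes "g \<in> balanced_words J q"
  shows "length g = q * J" and "set g \<subseteq> {1..J}"
proof -
  have m: "mset g = repeat_mset q (mset_set {1..J})"
    using assms by (simp add: balanced_words_def permutations_of_multiset_def)
  then have "size (mset g) = q * J" by simp
  then show "length g = q * J" by simp
  have "set_mset (mset g) \<subseteq> {1..J}" unfolding m by (auto simp: count_mset_set' simp flip: count_greater_zero_iff split: if_splits)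
  then show "set g \<subseteq> {1..J}" by simp
qed

lemma sum_balanced_word:
  fixes h :: "nat \<Rightarrow> real"
  assumes "g \<in> balanced_words J q"
  shows "(\<Sum>i<q * J. h (g ! i)) = real q * (\<Sum>j=1..J. h j)"
proof -
  have m: "mset g = repeat_mset q (mset_set {1..J})"
    using assms by (simp add: balanced_words_def permutations_of_multiset_def)
  have "(\<Sum>i<q * J. h (g ! i)) = sum_list (map h g)"
    by (simp add: sum_list_sum_nth balanced_words_facts[OF assms] atLeast0LessThan)
  also have "\<dots> = sum_mset (image_mset h (mset g))" by (simp flip: sum_mset_sum_list)
  also have "\<dots> = real q * (\<Sum>j=1..J. h j)"
    unfolding m by (induction q) (simp_all add: sum_unfold_sum_mset algebra_simps)
  finally show ?thesis .
qed

lemma prod_balanced_word: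
  fixes h :: "nat \<Rightarrow> real"
  assumes "g \<in> balanced_words J q" "\<And>j. 1 \<le> j \<Longrightarrow> j \<le> J \<Longrightarrow> h j > 0"
  shows "(\<Prod>i<q * J. h (g ! i)) = (\<Prod>j=1..J. h j) ^ q"
proof -
  have g: "g ! i \<in> {1..J}" if "i < q * J" for i
    using balanced_words_facts[OF assms(1)] that by (metis nth_mem subsetD)
  have "(\<Prod>i<q * J. h (g ! i)) = (\<Prod>i<q * J. exp (ln (h (g ! i))))"
    using g assms(2) by (intro prod.cong refl) auto
  also have "\<dots> = exp (real q * (\<Sum>j=1..J. ln (h j)))"
    by (simp add: sum_balanced_word[OF assms(1), of "\<lambda>j. ln (h j)"] flip: exp_sum)
  also have "\<dots> = (\<Prod>j=1..J. exp (ln (h j))) ^ q"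
    by (simp add: exp_of_nat_mult exp_sum)
  also have "(\<Prod>j=1..J. exp (ln (h j))) = (\<Prod>j=1..J. h j)"
    using assms(2) by (intro prod.cong refl) auto
  finally show ?thesis .
qed

lemma card_balanced_words:
  assumes "q > 0"
  shows "card (balanced_words J q) * fact q ^ J = (fact (q * J) :: nat)"
proof -
  let ?M = "repeat_mset q (mset_set {1..J})"
  have "set_mset ?M = {1..J}"
    using assms by (auto simp: count_mset_set' simp flip: count_greater_zero_iff split: if_splits)
  then have "(\<Prod>x\<in>set_mset ?M. fact (count ?M x)) = (\<Prod>x\<in>{1..J}. fact q :: nat)"
    by (intro prod.cong) auto
  then show ?thesis
    using card_permutations_of_multiset_aux[of ?M] by (simp add: balanced_words_def)
qed

definition cell :: "nat \<Rightarrow> real \<Rightarrow> nat \<Rightarrow> int set" where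
  "cell J d j = {k. logit_node J j \<le> of_int k * d \<and> of_int k * d < logit_node J (Suc j)}"

lemma cell_disjoint:
  assumes "1 \<le> j" "j \<le> J" "1 \<le> k" "k \<le> J" "j \<noteq> k"
  shows "cell J d j \<inter> cell J d k = {}"
  using assms
proof (induction j k rule: linorder_wlog)
  case (le j k)
  have "logit_node J (Suc j) \<le> logit_node J k"
  proof (cases "Suc j = k")
    case False
    then show ?thesis using le logit_node_strict_mono[of "Suc j" k J] by simp
  qed simp
  then show ?case by (auto simp: cell_def)
qed blast

text \<open>The length of a cell is at least its probability \<open>1 / (J + 2)\<close> divided by the upper bound
\<open>(j + 1) / (J + 2) * ((J + 2 - j) / (J + 2))\<close> for the density \<open>u * (1 - u)\<close> on it. The spacing \<open>d\<close> is
so small that losing one point to rounding costs at most a factor \<open>1 - e\<close>.\<close>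

lemma card_cell_ge:
  assumes "1 \<le> j" "j \<le> J" "0 < d" "d \<le> e / (real J + 2)"
  shows "finite (cell J d j)"
    and "real (card (cell J d j)) \<ge> (1 - e) * (real J + 2) / ((real j + 1) * (real J + 2 - real j)) / d"
proof -
  define L where "L = (real J + 2) / ((real j + 1) * (real J + 2 - real j))"
  have "L > 0" unfolding L_def using assms by (intro divide_pos_pos mult_pos_pos) auto
  have step: "logit_node J (Suc j) - logit_node J j \<ge> L"
    using logit_node_step_ge[OF assms(1,2)] by (simp add: L_def)
  note c = card_int_multiples_ge[OF assms(3), of "logit_node J j" "logit_node J (Suc j)"]
  show "finite (cell J d j)" using c(1) step \<open>L > 0\<close> by (simp add: cell_def)
  have "0 < e / (real J + 2)" using assms by linarith
  then have "e > 0" by (simp add: zero_less_divide_iff)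
  have "(real j + 1) * (real J + 2 - real j) \<le> (real J + 2) * (real J + 2)"
    using assms by (intro mult_mono) auto
  then have "(real J + 2) / ((real J + 2) * (real J + 2)) \<le> L"
    unfolding L_def using assms by (intro divide_left_mono mult_pos_pos) auto
  then have "1 / (real J + 2) \<le> L" by simp
  then have "e * (1 / (real J + 2)) \<le> e * L" using \<open>e > 0\<close> by (intro mult_left_mono) auto
  then have "d \<le> e * L" using assms by simp
  then have "1 \<le> e * L / d" using assms by simp
  then have "(1 - e) * L / d \<le> L / d - 1" by (simp add: left_diff_distrib diff_divide_distrib)
  also have "\<dots> \<le> (logit_node J (Suc j) - logit_node J j) / d - 1"
    using step assms by (simp add: divide_right_mono)
  also have "\<dots> \<le> real (card (cell J d j))"
    using c(2) step \<open>L > 0\<close> by (simp add: cell_def)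
  finally show "real (card (cell J d j)) \<ge> (1 - e) * (real J + 2) / ((real j + 1) * (real J + 2 - real j)) / d"
    by (simp add: L_def)
qed

text \<open>The weight \<open>d i\<close> is the spacing, in units of the scale of the logistic distribution, of the values
that coordinate \<open>i\<close> can take.\<close>

definition typical_points :: "nat \<Rightarrow> nat \<Rightarrow> (nat \<Rightarrow> real) \<Rightarrow> (nat \<Rightarrow> int) set" where
  "typical_points J q d = (\<Union>g\<in>balanced_words J q. PiE {..<q * J} (\<lambda>i. cell J (d i) (g ! i)))"

lemma balanced_word_nth:
  assumes "g \<in> balanced_words J q" "i < q * J"
  shows "1 \<le> g ! i" "g ! i \<le> J"
proof -
  have "g ! i \<in> {1..J}"
    using balanced_words_facts[OF assms(1)] assms(2) by (metis nth_mem subsetD)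
  then show "1 \<le> g ! i" "g ! i \<le> J" by auto
qed

text \<open>The factorials in front count the balanced words; the remaining factors bound the number of
points belonging to one word.\<close>

definition count_bound :: "nat \<Rightarrow> nat \<Rightarrow> real \<Rightarrow> (nat \<Rightarrow> real) \<Rightarrow> real" where
  "count_bound J q e d =
    fact (q * J) / fact q ^ J * ((1 - e) * (real J + 2)) ^ (q * J) / fact (J + 1) ^ (2 * q) / (\<Prod>i<q * J. d i)"

lemma card_typical_points_ge:
  fixes d :: "nat \<Rightarrow> real"
  assumes "q > 0" "0 < e" "e < 1" and d: "\<And>i. i < q * J \<Longrightarrow> 0 < d i \<and> d i \<le> e / (real J + 2)"
  shows "finite (typical_points J q d)"
    and "real (card (typical_points J q d)) \<ge> count_bound J q e d"
proof -
  let ?n = "q * J"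
  define h where "h = (\<lambda>j. 1 / ((real j + 1) * (real J + 2 - real j)))"
  have h: "h j > 0" if "1 \<le> j" "j \<le> J" for j
    unfolding h_def using that by (intro divide_pos_pos mult_pos_pos) auto
  have fin: "finite (PiE {..<?n} (\<lambda>i. cell J (d i) (g ! i)))" if "g \<in> balanced_words J q" for g
    using balanced_word_nth[OF that] d by (intro finite_PiE card_cell_ge) auto
  then show "finite (typical_points J q d)" by (auto simp: typical_points_def)
  have disj: "PiE {..<?n} (\<lambda>i. cell J (d i) (g ! i)) \<inter> PiE {..<?n} (\<lambda>i. cell J (d i) (g' ! i)) = {}"
    if g: "g \<in> balanced_words J q" "g' \<in> balanced_words J q" "g \<noteq> g'" for g g'
  proof -
    obtain i where i: "i < ?n" "g ! i \<noteq> g' ! i"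
      using g balanced_words_facts(1) by (metis nth_equalityI)
    then have "cell J (d i) (g ! i) \<inter> cell J (d i) (g' ! i) = {}"
      using balanced_word_nth[OF g(1) i(1)] balanced_word_nth[OF g(2) i(1)] by (intro cell_disjoint) auto
    then show ?thesis using i(1) by (auto simp: PiE_iff)
  qed
  have each: "real (card (PiE {..<?n} (\<lambda>i. cell J (d i) (g ! i))))
      \<ge> ((1 - e) * (real J + 2)) ^ ?n * (\<Prod>j=1..J. h j) ^ q / (\<Prod>i<?n. d i)"
    if g: "g \<in> balanced_words J q" for g
  proof -
    have "((1 - e) * (real J + 2)) ^ ?n * (\<Prod>j=1..J. h j) ^ q / (\<Prod>i<?n. d i)
        = (\<Prod>i<?n. (1 - e) * (real J + 2) * h (g ! i) / d i)"
      by (simp add: prod_dividef prod.distrib prod_balanced_word[OF g, where h = h, OF h])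
    also have "\<dots> \<le> (\<Prod>i<?n. real (card (cell J (d i) (g ! i))))"
    proof (intro prod_mono conjI)
      fix i assume "i \<in> {..<?n}"
      then have i: "i < ?n" by simp
      note gi = balanced_word_nth[OF g i]
      show "0 \<le> (1 - e) * (real J + 2) * h (g ! i) / d i"
        using h[OF gi] assms d[OF i] by simp
      show "(1 - e) * (real J + 2) * h (g ! i) / d i \<le> real (card (cell J (d i) (g ! i)))"
        using card_cell_ge(2)[OF gi, of "d i" e] d[OF i] by (simp add: h_def)
    qed
    finally show ?thesis by (simp add: card_PiE)
  qed
  have hprod: "(\<Prod>j=1..J. h j) = 1 / (fact (J + 1))\<^sup>2"
  proof -
    have "(\<Prod>j=1..J. h j) = 1 / ((\<Prod>j=1..J. real j + 1) * (\<Prod>j=1..J. real J + 2 - real j))"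
      by (simp add: h_def prod_dividef prod.distrib)
    also have "(\<Prod>j=1..J. real J + 2 - real j) = (\<Prod>j=1..J. real j + 1)"
      by (subst prod.atLeastAtMost_rev) (auto intro!: prod.cong simp: of_nat_diff)
    also have "(\<Prod>j=1..J. real j + 1) = fact (J + 1)"
      by (induction J) (auto simp: algebra_simps)
    finally show ?thesis by (simp add: power2_eq_square)
  qed
  have words: "real (card (balanced_words J q)) = fact ?n / fact q ^ J"
  proof -
    have "real (card (balanced_words J q) * fact q ^ J) = real (fact ?n)"
      using card_balanced_words[OF assms(1)] by metis
    then show ?thesis by (simp add: field_simps)
  qed
  have "fact ?n / fact q ^ J * ((1 - e) * (real J + 2)) ^ ?n / fact (J + 1) ^ (2 * q) / (\<Prod>i<?n. d i)
     = (\<Sum>g\<in>balanced_words J q. ((1 - e) * (real J + 2)) ^ ?n * (\<Prod>j=1..J. h j) ^ q / (\<Prod>i<?n. d i))"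
    unfolding hprod by (simp add: words power_divide flip: power_mult)
  also have "\<dots> \<le> (\<Sum>g\<in>balanced_words J q. real (card (PiE {..<?n} (\<lambda>i. cell J (d i) (g ! i)))))"
    using each by (intro sum_mono) auto
  also have "\<dots> = real (card (typical_points J q d))"
    unfolding typical_points_def using fin disj by (subst card_UN_disjoint) auto
  finally show "real (card (typical_points J q d)) \<ge> count_bound J q e d"
    unfolding count_bound_def .
qed

section \<open>Size of the set of typical points\<close>

lemma ln_fact_ge: "ln (fact n :: real) \<ge> real n * ln (real n) - real n"
proof (induction n)
  case (Suc n)
  have "real n * ln (real (Suc n)) - real n * ln (real n) \<le> 1"
  proof (cases "n = 0")
    case False
    have "ln (real (Suc n) / real n) \<le> real (Suc n) / real n - 1"
      using False by (intro ln_le_minus_one) auto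
    also have "\<dots> = 1 / real n" using False by (simp add: field_simps)
    finally have "ln (real (Suc n)) - ln (real n) \<le> 1 / real n" using False by (simp add: ln_div)
    then have "real n * (ln (real (Suc n)) - ln (real n)) \<le> real n * (1 / real n)"
      by (intro mult_left_mono) auto
    then show ?thesis using False by (simp add: right_diff_distrib)
  qed simp
  moreover have "ln (fact (Suc n) :: real) = ln (real (Suc n)) + ln (fact n)"
    unfolding fact_Suc by (subst ln_mult) auto
  moreover have "real (Suc n) * ln (real (Suc n)) - real (Suc n)
      = real n * ln (real (Suc n)) + ln (real (Suc n)) - real n - 1"
    by (simp add: algebra_simps)
  ultimately show ?case using Suc.IH by linarith
qed simp

lemma ln_fact_le:
  assumes "n \<ge> 1"
  shows "ln (fact n :: real) \<le> real n * ln (real n) - real n + ln (real n) + 1"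
  using assms
proof (induction n rule: dec_induct)
  case (step n)
  have "ln (real n / real (Suc n)) \<le> real n / real (Suc n) - 1"
    using step by (intro ln_le_minus_one) auto
  also have "\<dots> = - 1 / real (Suc n)" by (simp add: field_simps)
  finally have "1 / real (Suc n) \<le> ln (real (Suc n)) - ln (real n)" using step by (simp add: ln_div)
  then have "real (Suc n) * (1 / real (Suc n)) \<le> real (Suc n) * (ln (real (Suc n)) - ln (real n))"
    by (intro mult_left_mono) auto
  then have "real (Suc n) * ln (real n) \<le> real (Suc n) * ln (real (Suc n)) - 1"
    by (simp add: right_diff_distrib del: of_nat_Suc)
  moreover have "real (Suc n) * ln (real n) = real n * ln (real n) + ln (real n)"
    by (simp add: algebra_simps)
  moreover have "ln (fact (Suc n) :: real) = ln (real (Suc n)) + ln (fact n)"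
    unfolding fact_Suc by (subst ln_mult) auto
  moreover have "real (Suc n) = real n + 1" by simp
  ultimately show ?case using step.IH by linarith
qed simp

lemma ln_multinomial_ge:
  assumes "q \<ge> 1" "J \<ge> 1"
  shows "ln (fact (q * J) :: real) - real J * ln (fact q) \<ge> real (q * J) * ln (real J) - real J * ln (real q) - real J"
proof -
  have "real J * ln (fact q :: real) \<le> real J * (real q * ln (real q) - real q + ln (real q) + 1)"
    using ln_fact_le[OF assms(1)] by (intro mult_left_mono) auto
  moreover have "ln (real (q * J)) = ln (real q) + ln (real J)" using assms by (simp add: ln_mult)
  then have "ln (fact (q * J) :: real) \<ge> real (q * J) * (ln (real q) + ln (real J)) - real (q * J)"
    using ln_fact_ge[of "q * J"] by simp
  ultimately show ?thesis by (simp add: algebra_simps)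
qed

text \<open>The logarithm of \<open>J\<close> times the geometric mean of the lower bounds for the cell lengths, a discrete
approximation of the entropy \<open>2\<close> of the logistic distribution.\<close>

definition entropy_rate :: "nat \<Rightarrow> real" where
  "entropy_rate J = ln (real J) + ln (real J + 2) - 2 * ln (fact (J + 1)) / real J"

lemma count_bound_pos:
  assumes "e < 1" "\<And>i. i < q * J \<Longrightarrow> 0 < d i"
  shows "count_bound J q e d > 0"
proof -
  have "(\<Prod>i<q * J. d i) > 0" using assms(2) by (intro prod_pos) auto
  then show ?thesis
    unfolding count_bound_def using assms(1) by (intro divide_pos_pos mult_pos_pos zero_less_power) auto
qed

lemma ln_count_bound_ge:
  fixes d :: "nat \<Rightarrow> real"
  assumes "J \<ge> 1" "q \<ge> 1" "e < 1" and d: "\<And>i. i < q * J \<Longrightarrow> 0 < d i \<and> d i \<le> D"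
  shows "ln (count_bound J q e d) \<ge>
    real (q * J) * (entropy_rate J + ln (1 - e) - ln D) - real J * ln (real q) - real J"
proof -
  have dprod: "(\<Prod>i<q * J. d i) > 0" using d by (intro prod_pos) auto
  have "ln (\<Prod>i<q * J. d i) = (\<Sum>i<q * J. ln (d i))" using d by (intro ln_prod) (auto, force)
  also have "\<dots> \<le> real (card {..<q * J}) * ln D"
  proof (intro sum_bounded_above)
    fix i assume "i \<in> {..<q * J}"
    then have "0 < d i" "d i \<le> D" using d[of i] by auto
    then show "ln (d i) \<le> ln D" by simp
  qed
  finally have 1: "ln (\<Prod>i<q * J. d i) \<le> real (q * J) * ln D" by simp
  define F where "F = (fact (q * J) :: real)"
  define G where "G = (fact q :: real)"
  define H where "H = (fact (J + 1) :: real)"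
  define X where "X = (1 - e) * (real J + 2)"
  define Y where "Y = (\<Prod>i<q * J. d i)"
  have pos: "F > 0" "G > 0" "H > 0" "X > 0" "Y > 0"
    using assms dprod by (auto simp: F_def G_def H_def X_def Y_def)
  have "ln (count_bound J q e d) = ln (F / G ^ J * X ^ (q * J) / H ^ (2 * q) / Y)"
    by (simp add: count_bound_def F_def G_def H_def X_def Y_def)
  also have "\<dots> = ln F - real J * ln G + real (q * J) * ln X - real (2 * q) * ln H - ln Y"
    using pos by (simp add: ln_div ln_mult ln_realpow)
  also have "ln X = ln (1 - e) + ln (real J + 2)"
    using assms by (simp add: X_def ln_mult)
  also have "real (2 * q) * ln H = real (q * J) * (2 * ln H / real J)"
    using assms(1) by simp
  finally have "ln (count_bound J q e d) = ln F - real J * ln G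
      + real (q * J) * (ln (1 - e) + ln (real J + 2)) - real (q * J) * (2 * ln H / real J) - ln Y" .
  moreover have "2 * ln H / real J = ln (real J) + ln (real J + 2) - entropy_rate J"
    by (simp add: entropy_rate_def H_def)
  ultimately have "ln (count_bound J q e d) = ln F - real J * ln G
      + real (q * J) * (ln (1 - e) + entropy_rate J - ln (real J)) - ln Y"
    by (simp add: right_diff_distrib distrib_left)
  moreover have "ln F - real J * ln G \<ge> real (q * J) * ln (real J) - real J * ln (real q) - real J"
    using ln_multinomial_ge[OF assms(2,1)] by (simp add: F_def G_def)
  ultimately show ?thesis
    using 1 unfolding Y_def[symmetric] by (simp only: right_diff_distrib distrib_left)
qed

section \<open>Two typical points that are close\<close>

text \<open>An upper bound for the average over the cells of the largest cost in the cell; it approaches the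
mean cost \<open>1\<close> of the logistic distribution.\<close>

definition mean_cost :: "nat \<Rightarrow> real" where
  "mean_cost J = 2 * ln (real J + 2) - 1 - 2 * ln (fact J) / real J"

lemma typical_points_cost_le:
  assumes "J \<ge> 1" "x \<in> typical_points J q d"
  shows "(\<Sum>i<q * J. logistic_cost (of_int (x i) * d i)) \<le> real (q * J) * mean_cost J"
proof -
  define h where "h = (\<lambda>j. 2 * ln (real J + 2) - 1 - ln (real j) - ln (real (Suc J - j)))"
  obtain g where g: "g \<in> balanced_words J q" "x \<in> PiE {..<q * J} (\<lambda>i. cell J (d i) (g ! i))"
    using assms by (auto simp: typical_points_def)
  have "(\<Sum>i<q * J. logistic_cost (of_int (x i) * d i)) \<le> (\<Sum>i<q * J. h (g ! i))"
  proof (intro sum_mono)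
    fix i assume i: "i \<in> {..<q * J}"
    then have "x i \<in> cell J (d i) (g ! i)" using g by (auto simp: PiE_iff)
    then show "logistic_cost (of_int (x i) * d i) \<le> h (g ! i)"
      using balanced_word_nth[OF g(1)] i unfolding h_def cell_def by (intro logistic_cost_le) auto
  qed
  also have "\<dots> = real q * (\<Sum>j=1..J. h j)" by (rule sum_balanced_word[OF g(1)])
  also have "(\<Sum>j=1..J. h j) = real J * (2 * ln (real J + 2) - 1) - (\<Sum>j=1..J. ln (real j)) - (\<Sum>j=1..J. ln (real (Suc J - j)))"
    by (simp add: h_def sum_subtractf)
  also have "(\<Sum>j=1..J. ln (real (Suc J - j))) = (\<Sum>j=1..J. ln (real j))"
    by (subst sum.atLeastAtMost_rev) (auto intro!: sum.cong)
  also have "(\<Sum>j=1..J. ln (real j)) = ln (fact J)"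
    by (induction J) (auto simp: ln_mult add_ac)
  also have "real q * (real J * (2 * ln (real J + 2) - 1) - ln (fact J) - ln (fact J)) = real (q * J) * mean_cost J"
    using assms(1) by (simp add: mean_cost_def field_simps)
  finally show ?thesis .
qed

lemma typical_points_abs_le:
  assumes "J \<ge> 1" "x \<in> typical_points J q d"
  shows "\<bar>\<Sum>i<q * J. of_int (x i) * d i\<bar> \<le> real (q * J) * ln (real J + 2)"
proof -
  obtain g where g: "g \<in> balanced_words J q" "x \<in> PiE {..<q * J} (\<lambda>i. cell J (d i) (g ! i))"
    using assms by (auto simp: typical_points_def)
  have "\<bar>\<Sum>i<q * J. of_int (x i) * d i\<bar> \<le> (\<Sum>i<q * J. \<bar>of_int (x i) * d i\<bar>)" by (rule sum_abs)
  also have "\<dots> \<le> real (card {..<q * J}) * ln (real J + 2)"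
  proof (intro sum_bounded_above)
    fix i assume i: "i \<in> {..<q * J}"
    then have "x i \<in> cell J (d i) (g ! i)" using g by (auto simp: PiE_iff)
    then show "\<bar>of_int (x i) * d i\<bar> \<le> ln (real J + 2)"
      using abs_logit_node_le[of "g ! i" J] abs_logit_node_le[of "Suc (g ! i)" J]
        balanced_word_nth[OF g(1), of i] i by (auto simp: cell_def)
  qed
  finally show ?thesis by simp
qed

text \<open>The bins have width \<open>1/T\<close> and some bin receives at least \<open>m\<close> typical points. If these \<open>m\<close> points
were pairwise at distance more than the stated bound, the sum of their distances would exceed
what \<open>sum_abs_diff_le_logistic_cost\<close>, applied in each coordinate, allows.\<close>

lemma exists_short_almost_relation:
  fixes d :: "nat \<Rightarrow> real" and e T :: real and J q m :: nat
  assumes J: "J \<ge> 1" and q: "q > 0" and e: "0 < e" "e < 1" and m: "m \<ge> 2" and T: "T > 0"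
    and d: "\<And>i. i < q * J \<Longrightarrow> 0 < d i \<and> d i \<le> e / (real J + 2)"
    and big: "real m * (2 * (T * (real (q * J) * ln (real J + 2))) + 2) \<le> count_bound J q e d"
  shows "\<exists>z :: nat \<Rightarrow> int. (\<exists>i<q * J. z i \<noteq> 0) \<and>
      (\<Sum>i<q * J. \<bar>of_int (z i)\<bar> * d i) \<le> 2 * real (q * J) * mean_cost J * (real m / (real m - 1)) \<and>
      T * \<bar>\<Sum>i<q * J. of_int (z i) * d i\<bar> < 1"
proof -
  let ?n = "q * J"
  define V where "V = typical_points J q d"
  define R where "R = T * (real ?n * ln (real J + 2))"
  define lam where "lam = 2 * real ?n * mean_cost J * (real m / (real m - 1))"
  define v where "v = (\<lambda>x :: nat \<Rightarrow> int. \<Sum>i<?n. of_int (x i) * d i)"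
  define B where "B = {\<lfloor>- R\<rfloor>..\<lfloor>R\<rfloor>}"
  have R: "R \<ge> 0" unfolding R_def using T by (intro mult_nonneg_nonneg) auto
  have finV: "finite V" and cardV: "real (card V) \<ge> real m * (2 * R + 2)"
    using card_typical_points_ge[OF q e, where d = d, OF d] big by (auto simp: V_def R_def)
  have into: "(\<lambda>x. \<lfloor>T * v x\<rfloor>) \<in> V \<rightarrow> B"
  proof
    fix x assume "x \<in> V"
    then have "\<bar>v x\<bar> \<le> real ?n * ln (real J + 2)"
      unfolding V_def v_def by (rule typical_points_abs_le[OF J])
    then have "T * \<bar>v x\<bar> \<le> R" unfolding R_def using T by (intro mult_left_mono) auto
    moreover have "\<bar>T * v x\<bar> = T * \<bar>v x\<bar>" using T by (simp add: abs_mult)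
    ultimately have "- R \<le> T * v x" "T * v x \<le> R" by linarith+
    then show "\<lfloor>T * v x\<rfloor> \<in> B" unfolding B_def by (auto intro: floor_mono)
  qed
  have B: "finite B" "B \<noteq> {}" using R by (auto simp: B_def intro: floor_mono)
  have cardB: "real (card B) \<le> 2 * R + 2" using R unfolding B_def by simp linarith
  \<comment> \<open>\<open>y\<close> is the index of a bin holding at least the average number of points\<close>
  obtain y where y: "card ((\<lambda>x. \<lfloor>T * v x\<rfloor>) -` {y} \<inter> V) * card B \<ge> card V"
    using pigeonhole_card[OF into finV B] by blast
  define F where "F = (\<lambda>x. \<lfloor>T * v x\<rfloor>) -` {y} \<inter> V"
  have "m \<le> card F"
  proof -
    have "real m * real (card B) \<le> real m * (2 * R + 2)" using cardB by (intro mult_left_mono) auto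
    also have "\<dots> \<le> real (card V)" by (rule cardV)
    also have "\<dots> \<le> real (card F) * real (card B)" using y unfolding F_def by (metis of_nat_le_iff of_nat_mult)
    finally show ?thesis using B by (simp add: card_gt_0_iff)
  qed
  then obtain S where S: "S \<subseteq> F" "card S = m" "finite S"
    by (rule obtain_subset_with_card_n)
  have SV: "S \<subseteq> V" using S by (auto simp: F_def)
  define D where "D = (\<lambda>x y :: nat \<Rightarrow> int. \<Sum>i<?n. \<bar>of_int (x i) * d i - of_int (y i) * d i\<bar>)"
  have "\<exists>x\<in>S. \<exists>y\<in>S. x \<noteq> y \<and> D x y \<le> lam"
  proof (rule ccontr)
    assume contr: "\<not> ?thesis"
    have "(\<Sum>x\<in>S. real (m - 1) * lam) < (\<Sum>x\<in>S. \<Sum>y\<in>S. D x y)"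
    proof (rule sum_strict_mono)
      fix x assume x: "x \<in> S"
      have ne: "S - {x} \<noteq> {}"
      proof
        assume "S - {x} = {}"
        then have "S = {x}" using x by auto
        then show False using S m by simp
      qed
      have "real (m - 1) * lam = (\<Sum>y\<in>S - {x}. lam)" using S x by (simp add: card_Diff_singleton)
      also have "\<dots> < (\<Sum>y\<in>S - {x}. D x y)"
        using contr x S ne by (intro sum_strict_mono) (auto simp: not_le)
      also have "\<dots> \<le> (\<Sum>y\<in>S. D x y)"
        using S by (intro sum_mono2) (auto simp: D_def intro!: sum_nonneg)
      finally show "real (m - 1) * lam < (\<Sum>y\<in>S. D x y)" .
    qed (use S m in auto)
    also have "(\<Sum>x\<in>S. \<Sum>y\<in>S. D x y) = (\<Sum>i<?n. \<Sum>x\<in>S. \<Sum>y\<in>S. \<bar>of_int (x i) * d i - of_int (y i) * d i\<bar>)"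
      unfolding D_def by (subst sum.swap[of _ "{..<?n}"])+ (simp add: sum.swap[of _ S "{..<?n}"])
    also have "\<dots> \<le> (\<Sum>i<?n. 2 * real m * (\<Sum>x\<in>S. logistic_cost (of_int (x i) * d i)))"
      using sum_abs_diff_le_logistic_cost[OF S(3)] S(2) by (intro sum_mono) auto
    also have "\<dots> = 2 * real m * (\<Sum>x\<in>S. \<Sum>i<?n. logistic_cost (of_int (x i) * d i))"
      by (simp add: sum.swap[of _ S] flip: sum_distrib_left)
    also have "\<dots> \<le> 2 * real m * (\<Sum>x\<in>S. real ?n * mean_cost J)"
      using SV by (intro mult_left_mono sum_mono typical_points_cost_le[OF J]) (auto simp: V_def)
    also have "\<dots> = real m * (2 * real m * real ?n * mean_cost J)" using S by simp
    also have "2 * real m * real ?n * mean_cost J = real (m - 1) * lam"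
      using m by (simp add: lam_def of_nat_diff)
    finally show False using S by simp
  qed
  then obtain x y where xy: "x \<in> S" "y \<in> S" "x \<noteq> y" "D x y \<le> lam" by blast
  define z where "z = (\<lambda>i. x i - y i)"
  have "\<exists>i<?n. z i \<noteq> 0"
  proof -
    have "x \<in> extensional {..<?n}" "y \<in> extensional {..<?n}"
      using xy SV by (auto simp: V_def typical_points_def PiE_def)
    then show ?thesis using xy(3) by (auto simp: z_def intro: extensionalityI)
  qed
  moreover have "(\<Sum>i<?n. \<bar>of_int (z i)\<bar> * d i) = D x y"
    unfolding D_def z_def
  proof (intro sum.cong refl)
    fix i assume "i \<in> {..<?n}"
    then have "d i > 0" using d by simp
    then show "\<bar>of_int (x i - y i)\<bar> * d i = \<bar>of_int (x i) * d i - of_int (y i) * d i\<bar>"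
      by (simp add: abs_mult flip: left_diff_distrib)
  qed
  moreover have "T * \<bar>\<Sum>i<?n. of_int (z i) * d i\<bar> < 1"
  proof -
    have "\<lfloor>T * v x\<rfloor> = \<lfloor>T * v y\<rfloor>" using xy S by (auto simp: F_def)
    then have "\<bar>T * v x - T * v y\<bar> < 1" by linarith
    moreover have "T * (\<Sum>i<?n. of_int (z i) * d i) = T * v x - T * v y"
      by (simp add: z_def v_def left_diff_distrib sum_subtractf right_diff_distrib)
    moreover have "T * \<bar>\<Sum>i<?n. of_int (z i) * d i\<bar> = \<bar>T * (\<Sum>i<?n. of_int (z i) * d i)\<bar>"
      using T by (simp add: abs_mult)
    ultimately show ?thesis by simp
  qed
  ultimately have "(\<exists>i<?n. z i \<noteq> 0) \<and> (\<Sum>i<?n. \<bar>of_int (z i)\<bar> * d i) \<le> lam \<and>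
      T * \<bar>\<Sum>i<?n. of_int (z i) * d i\<bar> < 1"
    using xy(4) by simp
  then show ?thesis unfolding lam_def by blast
qed

section \<open>From a short relation between primes to a triple\<close>

lemma rad_le:
  assumes "n > 0"
  shows "rad n \<le> n"
proof -
  have "rad n \<le> (\<Prod>p\<in>prime_factors n. p ^ multiplicity p n)"
    unfolding rad_def
  proof (intro prod_mono conjI)
    fix p assume p: "p \<in> prime_factors n"
    then have "multiplicity p n \<ge> 1" by (simp add: prime_factors_multiplicity Suc_le_eq)
    moreover have "p \<ge> 1" using p in_prime_factors_imp_prime prime_ge_1_nat by blast
    ultimately show "p \<le> p ^ multiplicity p n" by (intro self_le_power) auto
  qed simp
  also have "\<dots> = n" using prime_factorization_nat assms by metis
  finally show ?thesis .
qed

lemma rad_mult_le: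
  assumes "a > 0" "b > 0" "finite P" "prime_factors a \<subseteq> P" "\<And>p. p \<in> P \<Longrightarrow> prime p"
  shows "rad (a * b) \<le> \<Prod>P * b"
proof -
  have pos: "(\<Prod>Q) \<ge> (1::nat)" if "\<And>p. p \<in> Q \<Longrightarrow> prime p" for Q :: "nat set"
    using that prime_ge_1_nat by (intro prod_ge_1) auto
  have "prime_factors (a * b) \<subseteq> P \<union> prime_factors b"
    using assms by (auto simp: prime_factors_product)
  then have "rad (a * b) dvd \<Prod>(P \<union> prime_factors b)"
    unfolding rad_def using assms(3) by (intro prod_dvd_prod_subset) auto
  moreover have "\<Prod>(P \<union> prime_factors b) > 0"
    using pos[of "P \<union> prime_factors b"] assms(5) by (auto simp: Suc_le_eq)
  ultimately have "rad (a * b) \<le> \<Prod>(P \<union> prime_factors b)" by (intro dvd_imp_le)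
  also have "\<dots> \<le> \<Prod>(P \<union> prime_factors b) * \<Prod>(P \<inter> prime_factors b)"
    using pos[of "P \<inter> prime_factors b"] assms(5) by auto
  also have "\<dots> = \<Prod>P * rad b"
    unfolding rad_def using assms(3) by (intro prod.union_inter) auto
  also have "\<dots> \<le> \<Prod>P * b" using rad_le[OF assms(2)] by simp
  finally show ?thesis .
qed

text \<open>The radical of \<open>A - B\<close> is estimated trivially by \<open>A - B\<close>, and \<open>(A - B) / A \<le> ln A - ln B < 1 / T\<close>.\<close>

lemma abc_triple_of_close_coprime:
  fixes A B :: nat and T :: real
  assumes AB: "coprime A B" "0 < B" "B < A" and T: "T > 0" "T * (ln (real A) - ln (real B)) < 1"
    and P: "finite P" "\<And>p. p \<in> P \<Longrightarrow> prime p" "prime_factors A \<union> prime_factors B \<subseteq> P"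
  shows "\<exists>a b. a > 0 \<and> b > 0 \<and> a + b = A \<and> Gcd {a, b, A} = 1 \<and>
     T * real (rad (a * b * A)) < real A * real (\<Prod>P) \<and> T < real A"
proof (rule exI[of _ B], rule exI[of _ "A - B"], intro conjI)
  have "ln (real B / real A) \<le> real B / real A - 1" using AB by (intro ln_le_minus_one) auto
  then have "1 - real B / real A \<le> ln (real A) - ln (real B)" using AB by (simp add: ln_div)
  then have "T * (1 - real B / real A) < 1"
    using T by (meson le_less_trans mult_left_mono less_imp_le)
  moreover have "real (A - B) = real A * (1 - real B / real A)" using AB by (simp add: field_simps of_nat_diff)
  ultimately have gap: "T * real (A - B) < real A"
    using AB by (simp add: mult.left_commute)
  have "T * 1 \<le> T * real (A - B)" using AB T by (intro mult_left_mono) auto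
  then show "T < real A" using gap by simp
  have "rad (B * (A - B) * A) = rad (B * A * (A - B))" by (simp add: mult_ac)
  also have "\<dots> \<le> \<Prod>P * (A - B)"
    using AB P by (intro rad_mult_le) (auto simp: prime_factors_product)
  finally have "real (rad (B * (A - B) * A)) \<le> real (\<Prod>P) * real (A - B)"
    by (metis of_nat_le_iff of_nat_mult)
  then have "T * real (rad (B * (A - B) * A)) \<le> T * (real (\<Prod>P) * real (A - B))"
    using T by (intro mult_left_mono) auto
  also have "\<dots> = real (\<Prod>P) * (T * real (A - B))" by simp
  also have "\<dots> < real (\<Prod>P) * real A"
  proof (intro mult_strict_left_mono gap)
    have "real p > 0" if "p \<in> P" for p using P(2)[OF that] prime_gt_0_nat by simp
    then show "real (\<Prod>P) > 0" by (simp add: prod_pos)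
  qed
  finally show "T * real (rad (B * (A - B) * A)) < real A * real (\<Prod>P)" by (simp add: mult.commute)
  show "Gcd {B, A - B, A} = 1"
  proof -
    have "Gcd {B, A - B, A} dvd gcd A B" by (intro gcd_greatest Gcd_dvd) auto
    then show ?thesis using AB by simp
  qed
qed (use AB in auto)

text \<open>Splitting \<open>z\<close> into positive and negative parts gives coprime numbers \<open>A\<close> and \<open>B\<close> for which
\<open>ln A + ln B\<close> is the weighted norm of \<open>z\<close> and \<open>ln A - ln B\<close> is the small relation, whence
\<open>ln A\<close> is half of the norm up to \<open>1/2\<close>.\<close>

lemma abc_triple_of_almost_relation:
  fixes p :: "nat \<Rightarrow> nat" and z :: "nat \<Rightarrow> int" and T :: real
  assumes p: "\<And>i. i < n \<Longrightarrow> prime (p i)" "inj_on p {..<n}" and z: "\<exists>i<n. z i \<noteq> 0"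
    and T: "T \<ge> 1" "T * \<bar>\<Sum>i<n. of_int (z i) * ln (real (p i))\<bar> < 1"
  shows "\<exists>a b c. a > 0 \<and> b > 0 \<and> a + b = c \<and> Gcd {a, b, c} = 1 \<and>
     T * real (rad (a * b * c)) < real c * (\<Prod>i<n. real (p i)) \<and> T < real c \<and>
     ln (real c) \<le> ((\<Sum>i<n. \<bar>of_int (z i)\<bar> * ln (real (p i))) + 1) / 2"
proof -
  define pw where "pw = (\<lambda>z :: nat \<Rightarrow> int. \<Prod>i<n. p i ^ nat (z i))"
  define l where "l = (\<lambda>i. ln (real (p i)))"
  have p1: "p i > 1" if "i < n" for i using p(1)[OF that] prime_gt_1_nat by blast
  have lpos: "l i > 0" if "i < n" for i using p1[OF that] by (simp add: l_def)
  have pwpos: "pw z > 0" for z unfolding pw_def using p1 by (intro prod_pos) fastforce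
  have lnpw: "ln (real (pw z)) = (\<Sum>i<n. real (nat (z i)) * l i)" for z
  proof -
    have "ln (real (pw z)) = ln (\<Prod>i<n. real (p i) ^ nat (z i))" by (simp add: pw_def)
    also have "\<dots> = (\<Sum>i<n. ln (real (p i) ^ nat (z i)))"
      using p1 by (intro ln_prod) fastforce+
    also have "\<dots> = (\<Sum>i<n. real (nat (z i)) * l i)"
      unfolding l_def using p1 by (intro sum.cong refl ln_realpow)
    finally show ?thesis .
  qed
  have pf: "prime_factors (pw z) \<subseteq> p ` {..<n}" for z
  proof
    fix r assume "r \<in> prime_factors (pw z)"
    then have r: "prime r" "r dvd pw z" by auto
    then obtain i where i: "i < n" "r dvd p i ^ nat (z i)"
      unfolding pw_def using prime_dvd_prod_iff[of "{..<n}" r] by auto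
    then have "r dvd p i" using r prime_dvd_power by blast
    then have "r = p i" using r p(1)[OF i(1)] by (simp add: primes_dvd_imp_eq)
    then show "r \<in> p ` {..<n}" using i by auto
  qed
  have cop: "coprime (pw z) (pw (\<lambda>i. - z i))" for z
    unfolding pw_def
  proof (intro prod_coprime_left prod_coprime_right)
    fix i j assume ij: "i \<in> {..<n}" "j \<in> {..<n}"
    show "coprime (p i ^ nat (z i)) (p j ^ nat (- z j))"
    proof (cases "i = j")
      case True
      then show ?thesis by (cases "z i \<ge> 0") auto
    next
      case False
      then have "p i \<noteq> p j" using p(2) ij by (auto simp: inj_on_def)
      then have "coprime (p i) (p j)" using p(1) ij by (auto intro: primes_coprime)
      then show ?thesis by simp
    qed
  qed
  have prodP: "real (\<Prod>(p ` {..<n})) = (\<Prod>i<n. real (p i))"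
    using p(2) by (simp add: prod.reindex)
  have main: ?thesis if y: "\<exists>i<n. y i \<noteq> 0" "T * \<bar>\<Sum>i<n. of_int (y i) * l i\<bar> < 1"
      "pw (\<lambda>i. - y i) < pw y" "(\<Sum>i<n. \<bar>of_int (y i)\<bar> * l i) = (\<Sum>i<n. \<bar>of_int (z i)\<bar> * l i)"
    for y :: "nat \<Rightarrow> int"
  proof -
    let ?A = "pw y" and ?B = "pw (\<lambda>i. - y i)"
    have diff: "ln (real ?A) - ln (real ?B) = (\<Sum>i<n. of_int (y i) * l i)"
      unfolding lnpw sum_subtractf[symmetric]
    proof (intro sum.cong refl)
      fix i show "real (nat (y i)) * l i - real (nat (- y i)) * l i = of_int (y i) * l i"
        by (cases "y i \<ge> 0") auto
    qed
    have sum: "ln (real ?A) + ln (real ?B) = (\<Sum>i<n. \<bar>of_int (y i)\<bar> * l i)"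
      unfolding lnpw sum.distrib[symmetric]
    proof (intro sum.cong refl)
      fix i show "real (nat (y i)) * l i + real (nat (- y i)) * l i = \<bar>of_int (y i)\<bar> * l i"
        by (cases "y i \<ge> 0") auto
    qed
    have "ln (real ?A) - ln (real ?B) \<ge> 0" using y(3) pwpos by simp
    then have "T * (ln (real ?A) - ln (real ?B)) < 1" using y(2) diff by simp
    moreover have "1 * (ln (real ?A) - ln (real ?B)) \<le> T * (ln (real ?A) - ln (real ?B))"
      using T(1) \<open>ln (real ?A) - ln (real ?B) \<ge> 0\<close> by (intro mult_right_mono) auto
    ultimately have "ln (real ?A) \<le> ((\<Sum>i<n. \<bar>of_int (z i)\<bar> * l i) + 1) / 2"
      using sum y(4) by simp
    moreover have "\<exists>a b. a > 0 \<and> b > 0 \<and> a + b = ?A \<and> Gcd {a, b, ?A} = 1 \<and>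
       T * real (rad (a * b * ?A)) < real ?A * real (\<Prod>(p ` {..<n})) \<and> T < real ?A"
      using p(1) pf T(1) \<open>T * (ln (real ?A) - ln (real ?B)) < 1\<close>
      by (intro abc_triple_of_close_coprime[of ?A ?B] cop pwpos y(3)) auto
    ultimately show ?thesis unfolding prodP l_def by blast
  qed
  have "pw z \<noteq> pw (\<lambda>i. - z i)"
  proof
    assume eq: "pw z = pw (\<lambda>i. - z i)"
    then have "pw z = 1" using cop[of z] by simp
    then have "(\<Sum>i<n. real (nat (z i)) * l i) = 0" "(\<Sum>i<n. real (nat (- z i)) * l i) = 0"
      using lnpw[of z] lnpw[of "\<lambda>i. - z i"] eq by auto
    then have zero: "\<forall>i\<in>{..<n}. real (nat (z i)) * l i = 0" "\<forall>i\<in>{..<n}. real (nat (- z i)) * l i = 0"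
      using lpos by (subst (asm) sum_nonneg_eq_0_iff; force)+
    have "z i = 0" if "i < n" for i
    proof -
      have "nat (z i) = 0" "nat (- z i) = 0" using zero lpos[OF that] that by auto
      then show ?thesis by linarith
    qed
    then show False using z by blast
  qed
  then consider "pw (\<lambda>i. - z i) < pw z" | "pw z < pw (\<lambda>i. - z i)" by linarith
  then show ?thesis
  proof cases
    case 1
    then show ?thesis using z T(2) by (intro main[of z]) (auto simp: l_def)
  next
    case 2
    then show ?thesis using z T(2) by (intro main[of "\<lambda>i. - z i"]) (auto simp: l_def sum_negf)
  qed
qed

text \<open>Only an upper bound for \<open>ln c\<close> is available; monotonicity turns it into a bound for the exponent of
the theorem.\<close>

lemma sqrt_over_ln_mono:
  fixes x y :: real
  assumes "exp 2 \<le> x" "x \<le> y"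
  shows "sqrt x / ln x \<le> sqrt y / ln y"
proof -
  have x: "x > 0" using assms(1) exp_gt_zero[of "2::real"] by linarith
  have lx: "ln x \<ge> 2" using assms(1) x by (subst ln_ge_iff) auto
  have ly: "ln y \<ge> ln x" using assms x by simp
  have "ln (sqrt y / sqrt x) \<le> sqrt y / sqrt x - 1" using x assms by (intro ln_le_minus_one) auto
  moreover have "ln (sqrt y / sqrt x) = (ln y - ln x) / 2" using x assms by (simp add: ln_div ln_sqrt)
  ultimately have "(ln y - ln x) / 2 \<le> sqrt y / sqrt x - 1" by metis
  then have "ln y \<le> ln x + 2 * (sqrt y / sqrt x - 1)" by argo
  then have "sqrt x * ln y \<le> sqrt x * (ln x + 2 * (sqrt y / sqrt x - 1))"
    using x by (intro mult_left_mono) auto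
  also have "\<dots> = sqrt x * ln x + 2 * (sqrt y - sqrt x)" using x by (simp add: field_simps)
  also have "\<dots> \<le> sqrt x * ln x + ln x * (sqrt y - sqrt x)"
    using assms lx by (intro add_left_mono mult_right_mono) auto
  also have "\<dots> = sqrt y * ln x" by (simp add: algebra_simps)
  finally show ?thesis using lx ly by (simp add: divide_simps mult.commute)
qed

text \<open>The spacings of the lattice of scaled exponent vectors are \<open>ln p / s\<close>, so bins of width \<open>1 / T\<close> for
the relation become bins of width \<open>1 / (T * s)\<close>. The hypothesis on \<open>ln T\<close> says that there are at
least \<open>m\<close> times as many typical points as bins.\<close>

lemma exists_abc_triple_over_primes:
  fixes P :: "nat set" and e s T L :: real and J q m :: nat
  assumes P: "finite P" "card P = q * J" "\<And>p. p \<in> P \<Longrightarrow> prime p" "\<And>p. p \<in> P \<Longrightarrow> ln (real p) \<le> L"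
    and J: "J \<ge> 1" and q: "q \<ge> 1" and e: "0 < e" "e < 1" and m: "m \<ge> 2" and T: "T \<ge> 1"
    and s: "s > 0" "L \<le> e * s / (real J + 2)" "1 \<le> T * (real (q * J) * s * ln (real J + 2))"
    and big: "ln T + ln (4 * real m * real (q * J) * s * ln (real J + 2))
       \<le> real (q * J) * (entropy_rate J + ln (1 - e) - ln L + ln s) - real J * ln (real q) - real J"
  shows "\<exists>a b c. a > 0 \<and> b > 0 \<and> a + b = c \<and> Gcd {a, b, c} = 1 \<and>
     T * real (rad (a * b * c)) < real c * real (\<Prod>P) \<and> T < real c \<and>
     ln (real c) \<le> real (q * J) * s * (mean_cost J * (real m / (real m - 1))) + 1 / 2"
proof -
  let ?n = "q * J"
  obtain p where "bij_betw p {0..<card P} P" using ex_bij_betw_nat_finite[OF P(1)] by blast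
  then have p: "bij_betw p {..<?n} P" by (simp add: atLeast0LessThan P(2))
  have pi: "p i \<in> P" if "i < ?n" for i using p that by (auto simp: bij_betw_def)
  define l where "l = (\<lambda>i. ln (real (p i)))"
  have l: "0 < l i" "l i \<le> L" if "i < ?n" for i
    using P(3,4)[OF pi[OF that]] prime_gt_1_nat[of "p i"] by (auto simp: l_def)
  have "0 < ?n" using J q by simp
  then have L: "L > 0" using l[of 0] by linarith
  define d where "d = (\<lambda>i. l i / s)"
  have d: "0 < d i" "d i \<le> L / s" if "i < ?n" for i
    using l[OF that] s by (auto simp: d_def divide_right_mono)
  have Ls: "L / s \<le> e / (real J + 2)" using s by (simp add: divide_simps mult_ac)
  define W where "W = 4 * real m * real ?n * s * ln (real J + 2)"
  have lnJ: "ln (real J + 2) > 0" using J by simp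
  have W: "W > 0" unfolding W_def using m s lnJ \<open>0 < ?n\<close> by (intro mult_pos_pos) auto
  have *: "ln (count_bound J q e d) \<ge> real ?n * (entropy_rate J + ln (1 - e) - ln (L / s)) - real J * ln (real q) - real J"
    using d by (intro ln_count_bound_ge J q e) auto
  have "ln (T * W) \<le> ln (count_bound J q e d)"
  proof -
    have "ln (T * W) = ln T + ln W" using T W by (simp add: ln_mult)
    moreover have "ln (L / s) = ln L - ln s" using L s by (simp add: ln_div)
    moreover have "entropy_rate J + ln (1 - e) - (ln L - ln s) = entropy_rate J + ln (1 - e) - ln L + ln s" by simp
    ultimately show ?thesis using big * unfolding W_def[symmetric] by (metis order_trans)
  qed
  then have TW: "T * W \<le> count_bound J q e d"
    using T W count_bound_pos[of e q J d] e d(1) by (subst (asm) ln_le_cancel_iff) auto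
  have "real m * (2 * (T * s * (real ?n * ln (real J + 2))) + 2) \<le> real m * (4 * (T * (real ?n * s * ln (real J + 2))))"
    using s(3) by (intro mult_left_mono) (auto simp: mult_ac)
  also have "\<dots> = T * W" by (simp add: W_def)
  finally have "real m * (2 * (T * s * (real ?n * ln (real J + 2))) + 2) \<le> count_bound J q e d"
    using TW by linarith
  then obtain z :: "nat \<Rightarrow> int" where z: "\<exists>i<?n. z i \<noteq> 0"
      "(\<Sum>i<?n. \<bar>of_int (z i)\<bar> * d i) \<le> 2 * real ?n * mean_cost J * (real m / (real m - 1))"
      "T * s * \<bar>\<Sum>i<?n. of_int (z i) * d i\<bar> < 1"
    using exists_short_almost_relation[of J q e m "T * s" d] J q e m T s(1) d Ls
    by (smt (verit) mult_pos_pos less_le_trans zero_less_one)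
  have zd: "(\<Sum>i<?n. f i * d i) = (\<Sum>i<?n. f i * l i) / s" for f :: "nat \<Rightarrow> real"
    by (simp add: d_def sum_divide_distrib)
  define S where "S = (\<Sum>i<?n. \<bar>of_int (z i)\<bar> * l i)"
  have "S / s \<le> 2 * real ?n * mean_cost J * (real m / (real m - 1))"
    using z(2) unfolding zd S_def .
  then have "S / s * s \<le> 2 * real ?n * mean_cost J * (real m / (real m - 1)) * s"
    using s by (intro mult_right_mono) auto
  then have S: "S \<le> 2 * (real ?n * s * (mean_cost J * (real m / (real m - 1))))"
    using s by (simp add: mult_ac)
  have "T * \<bar>\<Sum>i<?n. of_int (z i) * ln (real (p i))\<bar> < 1"
    using z(3) s unfolding zd by (simp add: abs_divide l_def)
  then obtain a b c where abc: "a > 0" "b > 0" "a + b = c" "Gcd {a, b, c} = 1"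
     "T * real (rad (a * b * c)) < real c * (\<Prod>i<?n. real (p i))" "T < real c" "ln (real c) \<le> (S + 1) / 2"
    using abc_triple_of_almost_relation[of ?n p z T] P(3) pi p z(1) T
    unfolding S_def l_def bij_betw_def by blast
  moreover have "(\<Prod>i<?n. real (p i)) = real (\<Prod>P)"
    using prod.reindex_bij_betw[OF p, of real] by simp
  moreover have "ln (real c) \<le> real ?n * s * (mean_cost J * (real m / (real m - 1))) + 1 / 2"
    using S abc(7) by argo
  ultimately show ?thesis by (intro exI[of _ a] exI[of _ b] exI[of _ c]) simp
qed

section \<open>Choice of the parameters\<close>

text \<open>As \<open>J\<close> grows, \<open>entropy_rate J\<close> tends to \<open>2\<close> and \<open>mean_cost J\<close> to \<open>1\<close>, by Stirling's formula.\<close>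

lemma good_number_of_cells:
  "\<exists>J\<ge>1. entropy_rate J \<ge> (19995 / 10000) \<and> mean_cost J \<le> (10002 / 10000)"
proof -
  have "eventually (\<lambda>J::nat. ln (real J) + ln (real J + 2)
      - 2 * ((real J + 1) * ln (real J + 1) - (real J + 1) + ln (real J + 1) + 1) / real J \<ge> (19995 / 10000)) at_top"
    by real_asymp
  moreover have "eventually (\<lambda>J::nat. 2 * ln (real J + 2) - 1
      - 2 * (real J * ln (real J) - real J) / real J \<le> (10002 / 10000)) at_top"
    by real_asymp
  ultimately have "eventually (\<lambda>J::nat. J \<ge> 1 \<and> ln (real J) + ln (real J + 2)
      - 2 * ((real J + 1) * ln (real J + 1) - (real J + 1) + ln (real J + 1) + 1) / real J \<ge> (19995 / 10000) \<and>
      2 * ln (real J + 2) - 1 - 2 * (real J * ln (real J) - real J) / real J \<le> (10002 / 10000)) at_top"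
    using eventually_ge_at_top[of "1::nat"] by eventually_elim blast
  then obtain J :: nat where J: "J \<ge> 1"
    "ln (real J) + ln (real J + 2)
      - 2 * ((real J + 1) * ln (real J + 1) - (real J + 1) + ln (real J + 1) + 1) / real J \<ge> (19995 / 10000)"
    "2 * ln (real J + 2) - 1 - 2 * (real J * ln (real J) - real J) / real J \<le> (10002 / 10000)"
    using eventually_happens'[OF trivial_limit_at_top_linorder] by blast
  have "2 * ln (fact (J + 1)) / real J
      \<le> 2 * ((real J + 1) * ln (real J + 1) - (real J + 1) + ln (real J + 1) + 1) / real J"
    using ln_fact_le[of "J + 1"] by (intro divide_right_mono mult_left_mono) (auto simp: add_ac)
  moreover have "2 * (real J * ln (real J) - real J) / real J \<le> 2 * ln (fact J) / real J"
    using ln_fact_ge[of J] by (intro divide_right_mono mult_left_mono) auto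
  ultimately show ?thesis using J unfolding entropy_rate_def mean_cost_def by (intro exI[of _ J]) linarith
qed

lemma exp_1_ge: "exp (1::real) \<ge> (2715 / 1000)"
proof -
  have "((2715 / 1000) :: real) \<le> (1 + 1/16 + (1/16)\<^sup>2 / 2) ^ 16" by (simp add: field_simps power_divide)
  also have "\<dots> \<le> exp (1/16) ^ 16"
    by (intro power_mono exp_lower_Taylor_quadratic) auto
  also have "\<dots> = exp 1" by (simp flip: exp_of_nat_mult)
  finally show ?thesis .
qed

text \<open>The factors \<open>1001 / 1000\<close> absorb the mean cost, the number \<open>m\<close> of points in a bin and the quotient
of \<open>ln N\<close> by \<open>ln n\<close>; the right side is below the rate \<open>2\<close> gained per prime. The margin exists because
\<open>6.563 < 4 * sqrt (exp 1)\<close>.\<close>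

lemma exponent_constant_le:
  "6.563 * (sqrt ((1001 / 1000) / exp 1) * (1001 / 1000) / 2) \<le> ((1995 / 1000) :: real)"
proof -
  have "((1001 / 1000) :: real) / exp 1 \<le> (1001 / 1000) / (2715 / 1000)" using exp_1_ge by (intro divide_left_mono) auto
  also have "\<dots> \<le> ((6073 / 10000))\<^sup>2" by (simp add: power2_eq_square)
  finally have "sqrt ((1001 / 1000) / exp 1) \<le> (6073 / 10000)" by (intro real_le_lsqrt) auto
  then show ?thesis by simp
qed

text \<open>The parameters are chosen as in the overview, \<open>T\<close> being \<open>\<Prod>P * exp (1.995 * n)\<close>. The additive
errors are at most a constant multiple of \<open>ln N\<close>, whereas \<open>n\<close> is at least of order \<open>N / (ln N)\<^sup>2\<close>.\<close>

lemma exists_abc_triple: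
  fixes C0 :: real
  shows "\<exists>a b c :: nat. a > 0 \<and> b > 0 \<and> a + b = c \<and> Gcd {a, b, c} = 1 \<and>
    real c > real (rad (a * b * c)) * exp (6.563 * sqrt (ln (real c)) / ln (ln (real c))) \<and> real c > C0"
proof -
  define K where "K = (6.563 :: real)"
  \<comment> \<open>\<open>6.563 / (2 * sqrt (exp 1))\<close> is about \<open>1.9903\<close>; these losses keep the rate above \<open>1.995\<close>\<close>
  define A e :: real where "A = (9995 / 10000)" and "e = (5 / 10000)"
  define m :: nat where "m = 10001"
  obtain J where J: "J \<ge> 1" "entropy_rate J \<ge> (19995 / 10000)" "mean_cost J \<le> (10002 / 10000)"
    using good_number_of_cells by blast
  define C where "C = 4 * real m * ln (real J + 2) / exp 1"
  have lnJ: "ln (real J + 2) \<ge> 1" using exp_le J(1) by (subst ln_ge_iff) auto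
  have C: "C > 0" using lnJ by (simp add: C_def m_def)
  have A: "A > 0" "A < 1" "ln A \<ge> - (1 / 1000)"
    using ln_le_minus_one[of "1 / A"] by (simp_all add: A_def ln_div)
  have e: "0 < e" "e < 1" "ln (1 - e) \<ge> - (1 / 1000)" using A(3) by (simp_all add: A_def e_def)
  have E: "eventually (\<lambda>N::nat.
       real J * ln N + real J + ln C + 2 * ln N + 2 * ln (ln N) \<le> (1 / 1000) * (A * N / (ln N)\<^sup>2)) at_top"
      "eventually (\<lambda>N::nat. ln N \<le> (1001 / 1000) * (ln A + ln N - 2 * ln (ln N))) at_top"
      "eventually (\<lambda>N::nat. exp 1 * (real J + 2) / e \<le> A * N / ln N) at_top"
      "eventually (\<lambda>N::nat. (ln N)\<^sup>2 / exp 1 \<ge> 1) at_top"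
      "eventually (\<lambda>N::nat. A * N / (ln N)\<^sup>2 \<ge> 10000 + \<bar>C0\<bar>) at_top"
    using A(1,2) unfolding e_def by real_asymp+
  have "eventually (\<lambda>N::nat. N \<ge> (3::nat) \<and>
       real J * ln N + real J + ln C + 2 * ln N + 2 * ln (ln N) \<le> (1 / 1000) * (A * N / (ln N)\<^sup>2) \<and>
       ln N \<le> (1001 / 1000) * (ln A + ln N - 2 * ln (ln N)) \<and>
       exp 1 * (real J + 2) / e \<le> A * N / ln N \<and> (ln N)\<^sup>2 / exp 1 \<ge> 1 \<and>
       A * N / (ln N)\<^sup>2 \<ge> 10000 + \<bar>C0\<bar>) at_top"
    using E eventually_ge_at_top[of "3::nat"] by eventually_elim blast
  then obtain N0 :: nat where N0: "\<And>N. N \<ge> N0 \<Longrightarrow> N \<ge> (3::nat) \<and>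
       real J * ln N + real J + ln C + 2 * ln N + 2 * ln (ln N) \<le> (1 / 1000) * (A * N / (ln N)\<^sup>2) \<and>
       ln N \<le> (1001 / 1000) * (ln A + ln N - 2 * ln (ln N)) \<and>
       exp 1 * (real J + 2) / e \<le> A * N / ln N \<and> (ln N)\<^sup>2 / exp 1 \<ge> 1 \<and>
       A * N / (ln N)\<^sup>2 \<ge> 10000 + \<bar>C0\<bar>"
    by (auto simp: eventually_at_top_linorder)
  obtain N P where N: "N \<ge> N0" and P: "P \<subseteq> primes_upto N" "J dvd card P"
      "(\<Sum>p\<in>P. ln (real N) - ln (real p)) \<ge> A * real N / ln (real N)"
    using many_primes_with_divisible_card[OF A(1,2) J(1)] by blast
  define L where "L = ln (real N)"
  define n where "n = card P"
  have finP: "finite P" using P(1) finite_subset finite_primes_upto by blast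
  obtain q where q: "n = q * J" using P(2) unfolding n_def by (metis dvd_def mult.commute)
  have N3: "N \<ge> 3"
    and E1: "real J * L + real J + ln C + 2 * L + 2 * ln L \<le> (1 / 1000) * (A * real N / L\<^sup>2)"
    and E2: "L \<le> (1001 / 1000) * (ln A + L - 2 * ln L)"
    and E3: "exp 1 * (real J + 2) / e \<le> A * real N / L"
    and E4: "L\<^sup>2 / exp 1 \<ge> 1"
    and E5: "A * real N / L\<^sup>2 \<ge> 10000 + \<bar>C0\<bar>"
    using N0[OF N] unfolding L_def by auto
  have L1: "L \<ge> 1" using N3 exp_le unfolding L_def by (subst ln_ge_iff) auto
  have pP: "prime p" "p \<le> N" "p \<ge> 2" if "p \<in> P" for p
    using P(1) that prime_ge_2_nat by auto
  have lnp: "0 \<le> ln (real p)" "ln (real p) \<le> L" if "p \<in> P" for p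
    using pP[OF that] by (auto simp: L_def)
  have "n \<le> N"
  proof -
    have "n \<le> card {1..N}" unfolding n_def using pP by (intro card_mono) force+
    then show ?thesis by simp
  qed
  define B where "B = (\<Sum>p\<in>P. L - ln (real p))"
  have B: "B \<ge> A * real N / L" using P(3) by (simp add: B_def L_def)
  have "B \<le> real n * L"
    unfolding B_def n_def using lnp by (intro sum_bounded_above) auto
  then have nL: "real n * L \<ge> A * real N / L" using B by linarith
  then have nlow: "real n \<ge> A * real N / L\<^sup>2"
    using L1 by (simp add: power2_eq_square divide_simps mult_ac)
  then have n: "real n \<ge> 10000 + \<bar>C0\<bar>" using E5 by linarith
  then have npos: "n > 0" by (intro Nat.gr0I) auto
  then have qpos: "q \<ge> 1" using q by (cases q) auto
  have lnn: "ln A + L - 2 * ln L \<le> ln (real n)"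
  proof -
    have "ln (A * real N / L\<^sup>2) \<le> ln (real n)"
      using nlow npos A L1 N3 by (subst ln_le_cancel_iff) auto
    moreover have "ln (A * real N / L\<^sup>2) = ln A + L - 2 * ln L"
      using A L1 N3 by (simp add: ln_div ln_mult ln_realpow L_def)
    ultimately show ?thesis by simp
  qed
  have lnnL: "ln (real n) \<le> L" using \<open>n \<le> N\<close> npos by (simp add: L_def)
  have lnqL: "real J * ln (real q) \<le> real J * L"
  proof -
    have "q \<le> n" using q J(1) by simp
    then have "ln (real q) \<le> ln (real n)" using qpos npos by simp
    then show ?thesis using lnnL by (intro mult_left_mono) auto
  qed
  \<comment> \<open>the scale maximizing \<open>ln T - (\<Sum>p\<in>P. ln p)\<close> relative to \<open>sqrt (n * s) / ln (n * s)\<close>\<close>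
  define s where "s = real n * L\<^sup>2 / exp 1"
  have s: "s > 0" using npos L1 by (simp add: s_def)
  have lns: "ln s = ln (real n) + 2 * ln L - 1"
    using npos L1 by (simp add: s_def ln_div ln_mult ln_realpow)
  have ns: "real n * s \<ge> real n * real n"
  proof -
    have "real n * 1 \<le> real n * (L\<^sup>2 / exp 1)" using E4 by (intro mult_left_mono) auto
    then have "real n \<le> s" by (simp add: s_def)
    then show ?thesis by (intro mult_left_mono) auto
  qed
  have n1: "real n \<ge> 1" using npos by simp
  have Ls: "L \<le> e * s / (real J + 2)"
  proof -
    have "exp 1 * (real J + 2) / e \<le> real n * L" using E3 nL by linarith
    then have "exp 1 * (real J + 2) * L \<le> (real n * L * e) * L"
      using e L1 by (intro mult_right_mono) (auto simp: divide_le_eq)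
    then have "exp 1 * (L * (real J + 2)) \<le> exp 1 * (e * s)"
      by (simp add: s_def power2_eq_square mult_ac)
    then have "L * (real J + 2) \<le> e * s" by simp
    then show ?thesis by (simp add: pos_le_divide_eq)
  qed
  define W where "W = 4 * real m * real n * s * ln (real J + 2)"
  have W: "W > 0" unfolding W_def m_def using s npos lnJ by (intro mult_pos_pos) auto
  have lnW: "ln W \<le> ln C + 2 * L + 2 * ln L"
  proof -
    have "W = C * (real n)\<^sup>2 * L\<^sup>2" by (simp add: W_def C_def s_def power2_eq_square)
    then have "ln W = ln C + 2 * ln (real n) + 2 * ln L"
      using C npos L1 by (simp add: ln_mult ln_realpow)
    then show ?thesis using lnnL by linarith
  qed
  define T where "T = exp ((\<Sum>p\<in>P. ln (real p)) + (1995 / 1000) * real n)"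
  have lnT: "ln T = real n * L - B + (1995 / 1000) * real n"
    by (simp add: T_def B_def n_def sum_subtractf)
  have Tn: "T \<ge> exp ((1995 / 1000) * real n)"
    using lnp by (simp add: T_def sum_nonneg)
  have T1: "T \<ge> 1"
  proof -
    have "1 \<le> exp ((1995 / 1000) * real n)" by simp
    then show ?thesis using Tn by linarith
  qed
  have X: "1 \<le> T * (real n * s * ln (real J + 2))"
  proof -
    have "1 * 1 \<le> real n * real n" using n1 by (intro mult_mono) auto
    then have "1 \<le> real n * s" using ns by linarith
    then have "1 * (1 * 1) \<le> T * (real n * s * ln (real J + 2))"
      using T1 lnJ by (intro mult_mono) auto
    then show ?thesis by simp
  qed
  have big: "ln T + ln W \<le> real n * (entropy_rate J + ln (1 - e) - ln L + ln s) - real J * ln (real q) - real J"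
  proof -
    \<comment> \<open>\<open>y\<close> compares \<open>n\<close> with \<open>N / ln N\<close>; the bound for \<open>ln (A * y)\<close> makes the estimate uniform in \<open>y\<close>\<close>
    define y where "y = real N / (real n * L)"
    have y: "y > 0" using N3 npos L1 by (simp add: y_def)
    have lny: "ln y = L - ln (real n) - ln L"
      using N3 npos L1 by (simp add: y_def ln_div ln_mult L_def)
    have "ln (A * y) \<le> A * y - 1" using A y by (intro ln_le_minus_one) auto
    then have "ln A + ln y \<le> A * y - 1" using A y by (simp add: ln_mult)
    then have "real n * (ln A + ln y) \<le> real n * (A * y - 1)" by (intro mult_left_mono) auto
    also have "\<dots> = A * real N / L - real n"
      using npos L1 by (simp add: y_def right_diff_distrib)
    also have "\<dots> \<le> B - real n" using B by simp
    finally have 1: "real n * (ln A + ln y) \<le> B - real n" .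
    have 2: "real n * (entropy_rate J + ln (1 - e) + ln A) \<ge> real n * (19975 / 10000)"
      using J(2) A(3) e(3) by (intro mult_left_mono) auto
    have 3: "real J * L + real J + ln C + 2 * L + 2 * ln L \<le> (1 / 1000) * real n"
      using E1 nlow by (elim order_trans) simp
    have "real n * (entropy_rate J + ln (1 - e) - ln L + ln s)
       = real n * (entropy_rate J + ln (1 - e) + ln A) - real n * (ln A + ln y) + real n * L - real n"
      by (simp add: lns lny algebra_simps)
    then show ?thesis using 1 2 3 lnT lnW lnqL n1 by linarith
  qed
  have "\<exists>a b c. a > 0 \<and> b > 0 \<and> a + b = c \<and> Gcd {a, b, c} = 1 \<and>
      T * real (rad (a * b * c)) < real c * real (\<Prod>P) \<and> T < real c \<and>
      ln (real c) \<le> real n * s * (mean_cost J * (real m / (real m - 1))) + 1 / 2"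
    unfolding q
  proof (rule exists_abc_triple_over_primes[where e = e and L = L])
    show "card P = q * J" using q by (simp add: n_def)
    show "prime p" if "p \<in> P" for p using pP(1)[OF that] .
    show "ln (real p) \<le> L" if "p \<in> P" for p using lnp(2)[OF that] .
    show "m \<ge> 2" by (simp add: m_def)
    show "1 \<le> T * (real (q * J) * s * ln (real J + 2))" using X unfolding q .
    show "ln T + ln (4 * real m * real (q * J) * s * ln (real J + 2))
       \<le> real (q * J) * (entropy_rate J + ln (1 - e) - ln L + ln s) - real J * ln (real q) - real J"
      using big unfolding W_def q .
  qed (fact finP J(1) qpos e(1) e(2) T1 s Ls)+
  then obtain a b c where abc: "a > 0" "b > 0" "a + b = c" "Gcd {a, b, c} = 1"
      "T * real (rad (a * b * c)) < real c * real (\<Prod>P)" "T < real c"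
      "ln (real c) \<le> real n * s * (mean_cost J * (real m / (real m - 1))) + 1 / 2"
    by blast
  define h where "h = (1001 / 1000) * (real n * s)"
  have lnc_le: "ln (real c) \<le> h"
  proof -
    have "mean_cost J * (real m / (real m - 1)) \<le> (10002 / 10000) * (real m / (real m - 1))"
      using J(3) by (intro mult_right_mono) (auto simp: m_def)
    also have "\<dots> \<le> (10004 / 10000)" by (simp add: m_def)
    finally have "real n * s * (mean_cost J * (real m / (real m - 1))) \<le> real n * s * (10004 / 10000)"
      using s by (intro mult_left_mono) auto
    moreover have "10000 * 10000 \<le> real n * real n" using n by (intro mult_mono) auto
    ultimately show ?thesis using abc(7) ns unfolding h_def by linarith
  qed
  have lnc_ge: "ln (real c) \<ge> real n"
  proof -
    have "exp (real n) \<le> exp ((1995 / 1000) * real n)" by simp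
    then have "exp (real n) \<le> real c" using Tn abc(6) by linarith
    then show ?thesis using abc by (subst ln_ge_iff) auto
  qed
  have e2: "exp 2 \<le> ln (real c)"
  proof -
    have "exp (2::real) = exp 1 * exp 1" by (simp flip: exp_add)
    also have "\<dots> \<le> 3 * 3" using exp_le by (intro mult_mono) auto
    finally show ?thesis using lnc_ge n by linarith
  qed
  have h: "sqrt h = real n * L * sqrt ((1001 / 1000) / exp 1)"
  proof -
    have "h = (real n * L)\<^sup>2 * ((1001 / 1000) / exp 1)" by (simp add: h_def s_def power2_eq_square)
    then have "sqrt h = sqrt ((real n * L)\<^sup>2) * sqrt ((1001 / 1000) / exp 1)" by (simp only: real_sqrt_mult)
    then show ?thesis using L1 by simp
  qed
  have lnn_pos: "ln (real n) > 0" using n by (intro ln_gt_zero) auto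
  have lnh: "ln h \<ge> 2 * ln (real n)"
  proof -
    have "0 \<le> real n * s" using s by simp
    then have "(real n)\<^sup>2 \<le> h" using ns unfolding h_def power2_eq_square by linarith
    then have "ln ((real n)\<^sup>2) \<le> ln h" using npos s by (subst ln_le_cancel_iff) (auto simp: h_def)
    then show ?thesis using npos by (simp add: ln_realpow)
  qed
  have hpos: "h > 0" using s npos by (simp add: h_def)
  have "K * sqrt (ln (real c)) / ln (ln (real c)) \<le> K * (sqrt h / ln h)"
    using sqrt_over_ln_mono[OF e2 lnc_le] by (simp add: K_def)
  also have "\<dots> \<le> K * (sqrt h / (2 * ln (real n)))"
  proof (intro mult_left_mono divide_left_mono mult_pos_pos)
    show "0 < ln h" using lnh lnn_pos by linarith
  qed (use lnh lnn_pos hpos in \<open>auto simp: K_def\<close>)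
  also have "\<dots> = K * (real n * sqrt ((1001 / 1000) / exp 1) / 2 * (L / ln (real n)))"
    by (simp add: h mult_ac)
  also have "\<dots> \<le> K * (real n * sqrt ((1001 / 1000) / exp 1) / 2 * (1001 / 1000))"
  proof (intro mult_left_mono)
    show "L / ln (real n) \<le> (1001 / 1000)" using E2 lnn lnn_pos by (simp add: divide_le_eq)
  qed (auto simp: K_def)
  also have "\<dots> = real n * (6.563 * (sqrt ((1001 / 1000) / exp 1) * (1001 / 1000) / 2))" by (simp add: K_def)
  also have "\<dots> \<le> real n * (1995 / 1000)" using exponent_constant_le by (intro mult_left_mono) auto
  finally have expo: "K * sqrt (ln (real c)) / ln (ln (real c)) \<le> (1995 / 1000) * real n" by simp
  have Pexp: "real (\<Prod>P) = exp (\<Sum>p\<in>P. ln (real p))"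
  proof -
    have "exp (\<Sum>p\<in>P. ln (real p)) = (\<Prod>p\<in>P. exp (ln (real p)))" using finP by (rule exp_sum)
    also have "\<dots> = (\<Prod>p\<in>P. real p)" using pP(3) by (intro prod.cong refl exp_ln) force
    finally show ?thesis by simp
  qed
  then have Ppos: "real (\<Prod>P) > 0" by simp
  have "real (\<Prod>P) * exp (K * sqrt (ln (real c)) / ln (ln (real c))) \<le> T"
    unfolding Pexp T_def exp_add[symmetric] using expo by simp
  then have "real (rad (a * b * c)) * (real (\<Prod>P) * exp (K * sqrt (ln (real c)) / ln (ln (real c))))
      \<le> real (rad (a * b * c)) * T"
    by (intro mult_left_mono) auto
  also have "\<dots> < real c * real (\<Prod>P)" using abc(5) by (simp only: mult.commute)
  finally have "real (\<Prod>P) * (real (rad (a * b * c)) * exp (K * sqrt (ln (real c)) / ln (ln (real c))))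
      < real (\<Prod>P) * real c"
    by (simp only: mult_ac)
  then have "real (rad (a * b * c)) * exp (K * sqrt (ln (real c)) / ln (ln (real c))) < real c"
    using Ppos by (simp only: mult_less_cancel_left_pos)
  moreover have "real c > C0"
  proof -
    have "C0 \<le> real n" using n by linarith
    also have "\<dots> \<le> ln (real c)" by (rule lnc_ge)
    also have "\<dots> < real c" using abc by (intro ln_less_self) auto
    finally show ?thesis .
  qed
  ultimately show ?thesis using abc unfolding K_def by blast
qed

theorem mainTheorem1:
  shows "infinite {(a, b, c) :: nat \<times> nat \<times> nat | a b c.
    a > 0 \<and> b > 0 \<and> c > 0 \<and> Gcd {a, b, c} = 1 \<and> a + b = c \<and>
    real c > real (rad (a * b * c)) * exp (6.563 * sqrt (ln (real c)) / ln (ln (real c)))}"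
    (is "infinite ?X")
proof
  assume fin: "finite ?X"
  define M where "M = Max ((\<lambda>(a, b, c). c) ` ?X)"
  obtain a b c :: nat where abc: "a > 0" "b > 0" "a + b = c" "Gcd {a, b, c} = 1"
    "real c > real (rad (a * b * c)) * exp (6.563 * sqrt (ln (real c)) / ln (ln (real c)))" "real c > real M"
    using exists_abc_triple[of "real M"] by blast
  then have "(a, b, c) \<in> ?X" by auto
  then have "c \<in> (\<lambda>(a, b, c). c) ` ?X" by force
  then have "c \<le> M" unfolding M_def using fin by (intro Max_ge) auto
  with abc show False by simp
qed

end
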